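(* Let $T:[0,1]\to[0,1]$ be a Lorenz-like cusp map and let $(T_\epsilon)_{\epsilon>0}$ be a family of perturbations of $T$ satisfying Assumptions A–D, all as described in the context. Let $\rho$ and $\rho_\epsilon$ be the densities of the unique absolutely continuous invariant probability measures of $T$ and $T_\epsilon$ respectively. Then $$\lim_{\epsilon\to0^+}\|\rho-\rho_\epsilon\|_{L^1_m}=0,$$ where $m$ is Lebesgue measure on $[0,1]$.
   Context: **The unperturbed map.** $T:[0,1]\to[0,1]$ is a Markov map with a cusp at $x_0\in(0,1)$. The left branch $T_1:=T|_{[0,x_0]}$ is monotonically increasing, convex and uniformly expanding (also at the fixed point $0$). The right branch $T_2:=T|_{[x_0,1]}$ is monotonically decreasing and convex, with $|DT|$ bounded from below by a positive constant less than one. Both branches are onto $[0,1]$. The left and right derivatives blow up at $x_0$. $T$ is $C^1$ on $[0,1]\setminus\{x_0\}$ (one-sided derivatives at $0,1$) and of class $C^{1+\iota}$, for some $\iota\in(0,1)$, on $(0,x_0)\cup(x_0,1)$. The local behaviors are as follows ($c$ denotes a positive constant that may differ from line to line): - as $x\to0^+$: $T(x)=\alpha'x+\beta'x^{1+\psi}+o(x^{1+\psi})$, $DT(x)=\alpha'+cx^{\psi}+o(x^\psi)$, with $\alpha'>1$, $\beta'>0$, $\psi>1$; - as $x\to1^-$: $T(x)=\alpha(1-x)+\tilde\beta(1-x)^{1+\kappa}+o((1-x)^{1+\kappa})$, $DT(x)=-\alpha-c(1-x)^\kappa+o((1-x)^\kappa)$, with $0<\alpha<1$, $\tilde\beta>0$,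 $\kappa>1$; - as $x\to x_0^-$: $T(x)=1-A'(x_0-x)^{B'}+o((x_0-x)^{B'})$, $DT(x)=c(x_0-x)^{B'-1}+o((x_0-x)^{B'-1})$, with $A'>0$, $0<B'<1$; - as $x\to x_0^+$: $T(x)=1-A(x-x_0)^{B}+o((x-x_0)^{B})$, $DT(x)=-c(x-x_0)^{B-1}+o((x-x_0)^{B-1})$, with $A>0$, $0<B<1$. **Preimages of $x_0$.** $a_0:=T_2^{-1}x_0$, $a_0':=T_1^{-1}x_0$, and for $p\ge1$: $a_p':=T_1^{-p}a_0'$ and $a_p:=T_2^{-1}T_1^{-(p-1)}a_0'$. The point $b_1\in(x_0,a_0)$ is defined by $Tb_1=a_0$. **Further standing conditions on $T$.** (i) $d_{(1,0)}:=\inf_{x\in(b_1,a_0)}|DT(x)|>1$; (ii) $|DT(b_1)|\ge DT(a_0')$; (iii) for some $\alpha''$ with $1<\alpha''\le\min\{d_{(1,0)},\alpha'\}$, $|DT(a_{p-1})|\,DT(a'_{p-2})\cdots DT(a'_0)>\alpha''$ for all integers $1<p\le p^*:=\lfloor 1+\log(\alpha''\alpha^{-1})/\log\alpha'\rfloor$. **The perturbed maps.** For each (small) $\epsilon>0$, $T_\epsilon:[0,1]\to[0,1]$ is a map with cusp (maximum point) $x_{\epsilon,0}\in(0,1)$, $T_\epsilon(x_{\epsilon,0})=1$, having local behaviors at $0,1,x_{\epsilon,0}^{\mp}$ of the same form as those listed for $T$ (with $x_{\epsilon,0}$ in place of $x_0$ and $\epsilon$-dependent constants). The branches of $T_\epsilon$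 on $[0,x_{\epsilon,0}]$ and $[x_{\epsilon,0},1]$ are denoted $T_{\epsilon,1}$ and $T_{\epsilon,2}$; $a_{\epsilon,0}:=T_{\epsilon,2}^{-1}x_{\epsilon,0}$ and $b_{\epsilon,1}\in(x_{\epsilon,0},a_{\epsilon,0})$ is defined by $T_\epsilon b_{\epsilon,1}=a_{\epsilon,0}$. - *Assumption A.* $T_\epsilon$ is a Markov map of the unit interval, one-to-one and onto on each of the two branches $[0,x_{\epsilon,0})$ and $(x_{\epsilon,0},1]$ (each branch extended to the cusp maps onto $[0,1]$), convex on both sides, and of class $C^{1+\iota_\epsilon}$ on $(0,x_{\epsilon,0})\cup(x_{\epsilon,0},1)$. - *Assumption B.* With $\|\cdot\|_0$ the $C^0$-norm (sup-norm) on $[0,1]$, $\lim_{\epsilon\to0}\|T_\epsilon-T\|_0=0$. For every $x\in[0,1]$, $x\ne x_0$, there is $\epsilon(x)>0$ such that for all $\epsilon<\epsilon(x)$ the derivative $DT_\epsilon(x)$ exists and is finite, and $\lim_{\epsilon\to0}DT_\epsilon(x)=DT(x)$. Furthermore $\lim_{x\to x_0^+}\lim_{\epsilon\to0}\frac{DT_\epsilon(x)}{DT(x)}=\lim_{x\to x_0^-}\lim_{\epsilon\to0}\frac{DT_\epsilon(x)}{DT(x)}=1$. - *Assumption C.* Let $C_{h,\epsilon}$ and $\iota_\epsilon$ denote respectively the Hölder constant and the Hölder exponent of the derivative of $T_\epsilon$ on $(0,x_{\epsilon,0})\cup(x_{\epsilon,0},1)$, namely $|DT_\epsilon(x)-DT_\epsilon(y)|\le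 C_{h,\epsilon}|x-y|^{\iota_\epsilon}$ for any $x,y$ either in $(0,x_{\epsilon,0})$ or in $(x_{\epsilon,0},1)$. Then $C_{h,\epsilon}$ and $\iota_\epsilon$ converge, as $\epsilon\to0$, to the corresponding quantities for $T$ (the Hölder constant and exponent of $DT$ on $(0,x_0)\cup(x_0,1)$). - *Assumption D.* Set $d_{(\epsilon,1,0)}:=\inf_{x\in(b_{\epsilon,1},a_{\epsilon,0})}|DT_\epsilon(x)|$. Then $d_{(\epsilon,1,0)}>1$, and there exist a constant $d_c$ and $\epsilon_c=\epsilon(d_c)$ such that $|d_{(1,0)}-d_{(\epsilon,1,0)}|<d_c$ for all $\epsilon<\epsilon_c$. Under these assumptions $T$ and (for $\epsilon$ small) $T_\epsilon$ each admit a unique invariant probability measure absolutely continuous with respect to Lebesgue measure.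
   Formalization: A single Hölder constant for DT on all of (0,x₀) is incompatible with the blow-up of DT at the cusp; the C^{1+ι} condition and Assumption C are therefore taken locally: one exponent, a Hölder constant for each compact interval inside a branch, with convergence of constants for each interval. *)

theory Defs
  imports "HOL-Probability.Probability" "HOL-Library.Landau_Symbols"
begin

text \<open>Maps of the unit interval are total functions on the reals of which only the restriction to
  \<open>{0..1}\<close> matters; correspondingly derivatives are taken within \<open>{0..1}\<close>, so that they are
  one-sided at 0 and 1 and ordinary derivatives elsewhere.\<close>

abbreviation D :: "(real \<Rightarrow> real) \<Rightarrow> real \<Rightarrow> real" where
  "D S x \<equiv> vector_derivative S (at x within {0..1})"

abbreviation diff01 :: "(real \<Rightarrow> real) \<Rightarrow> real \<Rightarrow> bool" where
  "diff01 S x \<equiv> S differentiable (at x within {0..1})"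

definition behaviour_at_0 :: "(real \<Rightarrow> real) \<Rightarrow> real \<Rightarrow> bool" where
  "behaviour_at_0 S \<alpha>' \<longleftrightarrow> \<alpha>' > 1 \<and> (\<exists>\<beta>' \<psi> c. \<beta>' > 0 \<and> \<psi> > 1 \<and> c > 0 \<and>
     (\<lambda>x. S x - (\<alpha>' * x + \<beta>' * x powr (1 + \<psi>))) \<in> o[at_right 0](\<lambda>x. x powr (1 + \<psi>)) \<and>
     (\<lambda>x. D S x - (\<alpha>' + c * x powr \<psi>)) \<in> o[at_right 0](\<lambda>x. x powr \<psi>))"

definition behaviour_at_1 :: "(real \<Rightarrow> real) \<Rightarrow> real \<Rightarrow> bool" where
  "behaviour_at_1 S \<alpha> \<longleftrightarrow> 0 < \<alpha> \<and> \<alpha> < 1 \<and> (\<exists>\<beta> \<kappa> c. \<beta> > 0 \<and> \<kappa> > 1 \<and> c > 0 \<and>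
     (\<lambda>x. S x - (\<alpha> * (1 - x) + \<beta> * (1 - x) powr (1 + \<kappa>)))
        \<in> o[at_left 1](\<lambda>x. (1 - x) powr (1 + \<kappa>)) \<and>
     (\<lambda>x. D S x - (- \<alpha> - c * (1 - x) powr \<kappa>)) \<in> o[at_left 1](\<lambda>x. (1 - x) powr \<kappa>))"

definition behaviour_left_of_cusp :: "(real \<Rightarrow> real) \<Rightarrow> real \<Rightarrow> bool" where
  "behaviour_left_of_cusp S x0 \<longleftrightarrow> (\<exists>A' B' c. A' > 0 \<and> 0 < B' \<and> B' < 1 \<and> c > 0 \<and>
     (\<lambda>x. S x - (1 - A' * (x0 - x) powr B')) \<in> o[at_left x0](\<lambda>x. (x0 - x) powr B') \<and>
     (\<lambda>x. D S x - c * (x0 - x) powr (B' - 1)) \<in> o[at_left x0](\<lambda>x. (x0 - x) powr (B' - 1)))"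

definition behaviour_right_of_cusp :: "(real \<Rightarrow> real) \<Rightarrow> real \<Rightarrow> bool" where
  "behaviour_right_of_cusp S x0 \<longleftrightarrow> (\<exists>A B c. A > 0 \<and> 0 < B \<and> B < 1 \<and> c > 0 \<and>
     (\<lambda>x. S x - (1 - A * (x - x0) powr B)) \<in> o[at_right x0](\<lambda>x. (x - x0) powr B) \<and>
     (\<lambda>x. D S x - (- c * (x - x0) powr (B - 1))) \<in> o[at_right x0](\<lambda>x. (x - x0) powr (B - 1)))"

text \<open>The slopes \<open>\<alpha>'\<close> at 0 and \<open>- \<alpha>\<close> at 1 are explicit because further conditions mention them.\<close>

definition cusp_behaviour :: "(real \<Rightarrow> real) \<Rightarrow> real \<Rightarrow> real \<Rightarrow> real \<Rightarrow> bool" where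
  "cusp_behaviour S x0 \<alpha>' \<alpha> \<longleftrightarrow> behaviour_at_0 S \<alpha>' \<and> behaviour_at_1 S \<alpha> \<and>
     behaviour_left_of_cusp S x0 \<and> behaviour_right_of_cusp S x0"

text \<open>A bound \<open>\<bar>D S x - D S y\<bar> \<le> C * \<bar>x - y\<bar> powr \<iota>\<close> with a single constant \<open>C\<close> on the whole of
  \<open>{0<..<x0}\<close> would force \<open>D S\<close> to be bounded and so contradict its blow-up at \<open>x0\<close>.  Class
  \<open>C\<^sup>1\<^sup>+\<^sup>\<iota>\<close> on the open set \<open>{0<..<x0} \<union> {x0<..<1}\<close> therefore has its usual local meaning: there is
  one exponent, and the constant \<open>C u v\<close> may depend on the compact interval \<open>{u..v}\<close>.
  The single-constant version is the special case in which \<open>C\<close> is constant.\<close>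

definition in_one_branch :: "real \<Rightarrow> real \<Rightarrow> real \<Rightarrow> bool" where
  "in_one_branch x0 u v \<longleftrightarrow> u \<le> v \<and> (0 < u \<and> v < x0 \<or> x0 < u \<and> v < 1)"

definition C1_holder :: "(real \<Rightarrow> real) \<Rightarrow> real \<Rightarrow> real \<Rightarrow> (real \<Rightarrow> real \<Rightarrow> real) \<Rightarrow> bool" where
  "C1_holder S x0 \<iota> C \<longleftrightarrow> 0 < \<iota> \<and> \<iota> < 1 \<and>
     (\<forall>x\<in>{0<..<x0} \<union> {x0<..<1}. diff01 S x) \<and>
     (\<forall>u v. in_one_branch x0 u v \<longrightarrow>
        (\<forall>x\<in>{u..v}. \<forall>y\<in>{u..v}. \<bar>D S x - D S y\<bar> \<le> C u v * \<bar>x - y\<bar> powr \<iota>))"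

definition inv1 :: "(real \<Rightarrow> real) \<Rightarrow> real \<Rightarrow> real \<Rightarrow> real" where
  "inv1 S x0 = inv_into {0..x0} S"

definition inv2 :: "(real \<Rightarrow> real) \<Rightarrow> real \<Rightarrow> real \<Rightarrow> real" where
  "inv2 S x0 = inv_into {x0..1} S"

definition pre_a' :: "(real \<Rightarrow> real) \<Rightarrow> real \<Rightarrow> nat \<Rightarrow> real" where
  "pre_a' S x0 p = (inv1 S x0 ^^ p) (inv1 S x0 x0)"

definition pre_a :: "(real \<Rightarrow> real) \<Rightarrow> real \<Rightarrow> nat \<Rightarrow> real" where
  "pre_a S x0 p = (if p = 0 then inv2 S x0 x0 else inv2 S x0 ((inv1 S x0 ^^ (p - 1)) (pre_a' S x0 0)))"

definition point_b1 :: "(real \<Rightarrow> real) \<Rightarrow> real \<Rightarrow> real" where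
  "point_b1 S x0 = inv_into {x0<..<pre_a S x0 0} S (pre_a S x0 0)"

definition d10 :: "(real \<Rightarrow> real) \<Rightarrow> real \<Rightarrow> real" where
  "d10 S x0 = (INF x\<in>{point_b1 S x0<..<pre_a S x0 0}. \<bar>D S x\<bar>)"

definition cusp_map ::
    "(real \<Rightarrow> real) \<Rightarrow> real \<Rightarrow> real \<Rightarrow> real \<Rightarrow> real \<Rightarrow> (real \<Rightarrow> real \<Rightarrow> real) \<Rightarrow> bool" where
  "cusp_map T x0 \<alpha>' \<alpha> \<iota> C \<longleftrightarrow>
     0 < x0 \<and> x0 < 1 \<and>
     strict_mono_on {0..x0} T \<and> convex_on {0..x0} T \<and> T ` {0..x0} = {0..1} \<and>
     (\<exists>r>1. \<forall>x\<in>{0..<x0}. r \<le> D T x) \<and>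
     strict_antimono_on {x0..1} T \<and> convex_on {x0..1} T \<and> T ` {x0..1} = {0..1} \<and>
     (\<exists>r. 0 < r \<and> r < 1 \<and> (\<forall>x\<in>{x0<..1}. r \<le> \<bar>D T x\<bar>)) \<and>
     filterlim (D T) at_top (at_left x0) \<and> filterlim (D T) at_bot (at_right x0) \<and>
     (\<forall>x\<in>{0..1} - {x0}. diff01 T x) \<and> continuous_on ({0..1} - {x0}) (D T) \<and>
     C1_holder T x0 \<iota> C \<and>
     cusp_behaviour T x0 \<alpha>' \<alpha>"

definition expansion_conditions :: "(real \<Rightarrow> real) \<Rightarrow> real \<Rightarrow> real \<Rightarrow> real \<Rightarrow> bool" where
  "expansion_conditions T x0 \<alpha>' \<alpha> \<longleftrightarrow>
     d10 T x0 > 1 \<and>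
     \<bar>D T (point_b1 T x0)\<bar> \<ge> D T (pre_a' T x0 0) \<and>
     (\<exists>\<alpha>''. 1 < \<alpha>'' \<and> \<alpha>'' \<le> min (d10 T x0) \<alpha>' \<and>
        (\<forall>p::nat. 1 < p \<and> int p \<le> \<lfloor>1 + ln (\<alpha>'' * inverse \<alpha>) / ln \<alpha>'\<rfloor> \<longrightarrow>
           \<bar>D T (pre_a T x0 (p - 1))\<bar> * (\<Prod>k\<le>p - 2. D T (pre_a' T x0 k)) > \<alpha>''))"

definition lorenz_cusp_map ::
    "(real \<Rightarrow> real) \<Rightarrow> real \<Rightarrow> real \<Rightarrow> (real \<Rightarrow> real \<Rightarrow> real) \<Rightarrow> bool" where
  "lorenz_cusp_map T x0 \<iota> C \<longleftrightarrow>
     (\<exists>\<alpha>' \<alpha>. cusp_map T x0 \<alpha>' \<alpha> \<iota> C \<and> expansion_conditions T x0 \<alpha>' \<alpha>)"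

definition perturbed_cusp_map ::
    "(real \<Rightarrow> real) \<Rightarrow> real \<Rightarrow> real \<Rightarrow> (real \<Rightarrow> real \<Rightarrow> real) \<Rightarrow> bool" where
  "perturbed_cusp_map S x0 \<iota> C \<longleftrightarrow>
     0 < x0 \<and> x0 < 1 \<and> S x0 = 1 \<and>
     bij_betw S {0..x0} {0..1} \<and> bij_betw S {x0..1} {0..1} \<and>
     convex_on {0..x0} S \<and> convex_on {x0..1} S \<and>
     C1_holder S x0 \<iota> C \<and>
     (\<exists>\<alpha>' \<alpha>. cusp_behaviour S x0 \<alpha>' \<alpha>)"

text \<open>Families are indexed by \<open>\<epsilon>\<close>; limits for \<open>\<epsilon>\<close> to 0 are along \<open>at_right 0\<close>.\<close>

definition maps_converge :: "(real \<Rightarrow> real \<Rightarrow> real) \<Rightarrow> (real \<Rightarrow> real) \<Rightarrow> real \<Rightarrow> bool" where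
  "maps_converge T\<epsilon> T x0 \<longleftrightarrow>
     ((\<lambda>\<epsilon>. SUP x\<in>{0..1}. \<bar>T\<epsilon> \<epsilon> x - T x\<bar>) \<longlongrightarrow> 0) (at_right 0) \<and>
     (\<forall>x\<in>{0..1} - {x0}.
        (\<exists>e>0. \<forall>\<epsilon>. 0 < \<epsilon> \<and> \<epsilon> < e \<longrightarrow> diff01 (T\<epsilon> \<epsilon>) x) \<and>
        ((\<lambda>\<epsilon>. D (T\<epsilon> \<epsilon>) x) \<longlongrightarrow> D T x) (at_right 0)) \<and>
     ((\<lambda>x. Lim (at_right 0) (\<lambda>\<epsilon>. D (T\<epsilon> \<epsilon>) x / D T x)) \<longlongrightarrow> 1) (at_right x0) \<and>
     ((\<lambda>x. Lim (at_right 0) (\<lambda>\<epsilon>. D (T\<epsilon> \<epsilon>) x / D T x)) \<longlongrightarrow> 1) (at_left x0)"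

definition holder_data_converge ::
    "(real \<Rightarrow> real \<Rightarrow> real \<Rightarrow> real) \<Rightarrow> (real \<Rightarrow> real) \<Rightarrow> (real \<Rightarrow> real \<Rightarrow> real) \<Rightarrow> real \<Rightarrow> real \<Rightarrow> bool" where
  "holder_data_converge C\<epsilon> \<iota>\<epsilon> C \<iota> x0 \<longleftrightarrow>
     (\<iota>\<epsilon> \<longlongrightarrow> \<iota>) (at_right 0) \<and>
     (\<forall>u v. in_one_branch x0 u v \<longrightarrow> ((\<lambda>\<epsilon>. C\<epsilon> \<epsilon> u v) \<longlongrightarrow> C u v) (at_right 0))"

definition core_expansion_close ::
    "(real \<Rightarrow> real \<Rightarrow> real) \<Rightarrow> (real \<Rightarrow> real) \<Rightarrow> (real \<Rightarrow> real) \<Rightarrow> real \<Rightarrow> bool" where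
  "core_expansion_close T\<epsilon> x\<epsilon> T x0 \<longleftrightarrow>
     (\<forall>\<^sub>F \<epsilon> in at_right 0. d10 (T\<epsilon> \<epsilon>) (x\<epsilon> \<epsilon>) > 1) \<and>
     (\<exists>d\<^sub>c>0. \<exists>\<epsilon>\<^sub>c>0. \<forall>\<epsilon>. 0 < \<epsilon> \<and> \<epsilon> < \<epsilon>\<^sub>c \<longrightarrow> \<bar>d10 T x0 - d10 (T\<epsilon> \<epsilon>) (x\<epsilon> \<epsilon>)\<bar> < d\<^sub>c)"

abbreviation leb01 :: "real measure" where
  "leb01 \<equiv> restrict_space lborel {0..1}"

definition acip :: "(real \<Rightarrow> real) \<Rightarrow> real measure \<Rightarrow> bool" where
  "acip S \<mu> \<longleftrightarrow> S \<in> leb01 \<rightarrow>\<^sub>M leb01 \<and> sets \<mu> = sets leb01 \<and> prob_space \<mu> \<and>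
     absolutely_continuous leb01 \<mu> \<and> distr \<mu> leb01 S = \<mu>"

definition unique_acip_density :: "(real \<Rightarrow> real) \<Rightarrow> (real \<Rightarrow> real) \<Rightarrow> bool" where
  "unique_acip_density S \<rho> \<longleftrightarrow> (\<exists>\<mu>. acip S \<mu> \<and> (\<forall>\<nu>. acip S \<nu> \<longrightarrow> \<nu> = \<mu>) \<and>
     \<rho> \<in> borel_measurable leb01 \<and> (AE x in leb01. 0 \<le> \<rho> x) \<and>
     \<mu> = density leb01 (\<lambda>x. ennreal (\<rho> x)))"

end

theory Submission
  imports Defs
begin

text \<open>The transfer operator of a cusp map is studied on functions of bounded variation, and stability
follows from a Lasota--Yorke inequality that holds with the same constants for all nearby maps,
together with Helly's theorem and the uniqueness of the invariant density.

Let \<open>S\<close> be a map with two full branches, increasing on \<open>{0..c}\<close> and decreasing on \<open>{c..1}\<close>.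
If both branches are convex, then \<open>v = - 1 / S'\<close> (with \<open>v c = 0\<close>) is nondecreasing on the whole of
\<open>{0..1}\<close>, so that the Jacobian \<open>\<bar>v\<bar> = 1 / \<bar>S'\<bar>\<close> of the inverse branches has bounded variation although
\<open>S'\<close> is unbounded at the cusp.  Writing \<open>Q u y\<close> for the sum of \<open>u\<close> over the two preimages of \<open>y\<close>, the
\<open>n\<close>-th iterate of the transfer operator is \<open>f \<mapsto> Q\<^sup>n (q\<^sub>n f)\<close>, where \<open>q\<^sub>n = 1 / \<bar>(S\<^sup>n)'\<bar>\<close>.  Since the branches
are full and monotone, \<open>Q\<close> does not increase the variation.  Hence the variation of the \<open>n\<close>-th image
of a density \<open>f\<close> is at most that of \<open>q\<^sub>n f\<close>; cutting \<open>{0..1}\<close> into \<open>N\<close> equal cells on each of which \<open>q\<^sub>n\<close> has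
variation at most \<open>\<delta>\<close> bounds it by \<open>(sup q\<^sub>n + \<delta>) var f + \<delta> N\<close> (\<open>Lasota_Yorke\<close>).

For \<open>T\<close> the functions \<open>q\<^sub>n\<close> tend to 0 uniformly: by the expansion conditions, every point has a return
time, bounded by a fixed number, at which the iterate has derivative at least \<open>\<alpha>'' > 1\<close> in modulus
(\<open>cusp_map_expanding_iterate\<close>).  For the perturbed maps, \<open>v\<^sub>\<epsilon>\<close> is a family of monotone functions
converging pointwise to the continuous function \<open>v\<close>, hence uniformly; so \<open>q\<^sub>n\<close> converges uniformly
as well, its variation over short intervals is uniformly small, and the Lasota--Yorke inequality holds
with constants independent of \<open>\<epsilon>\<close>.  All iterates of the constant density under the transfer operators
of all sufficiently close maps therefore have variation bounded by one constant (\<open>uniform_variation_bound\<close>).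

By Helly's theorem a sequence of densities of uniformly bounded variation which is asymptotically invariant under
maps converging to \<open>T\<close> has an \<open>L\<^sup>1\<close>-limit point that is an invariant density of \<open>T\<close>, and by uniqueness this
is \<open>\<rho>\<close> (\<open>asymptotically_invariant_limit\<close>).  The principle is used twice: for a single perturbed map and the
averages of the iterates of the constant density, which puts near \<open>\<rho>\<^sub>\<epsilon>\<close> a density of controlled
variation; and then for these densities as \<open>\<epsilon>\<close> tends to 0.\<close>

section \<open>Functions of bounded variation\<close>

text \<open>A function \<open>V\<close> majorises \<open>f\<close> on \<open>{a..b}\<close> if every increment of \<open>f\<close> is bounded by the corresponding increment
of \<open>V\<close>; such a \<open>V\<close> is automatically nondecreasing.  The least increment \<open>V b - V a\<close> is the total variation
of \<open>f\<close>, so \<open>var_le f a b M\<close> says that the total variation of \<open>f\<close> on \<open>{a..b}\<close> is at most \<open>M\<close>.\<close>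
definition majorant :: "(real \<Rightarrow> real) \<Rightarrow> (real \<Rightarrow> real) \<Rightarrow> real \<Rightarrow> real \<Rightarrow> bool" where
  "majorant V f a b \<longleftrightarrow> (\<forall>x y. a \<le> x \<longrightarrow> x \<le> y \<longrightarrow> y \<le> b \<longrightarrow> \<bar>f y - f x\<bar> \<le> V y - V x)"

definition var_le :: "(real \<Rightarrow> real) \<Rightarrow> real \<Rightarrow> real \<Rightarrow> real \<Rightarrow> bool" where
  "var_le f a b M \<longleftrightarrow> (\<exists>V. majorant V f a b \<and> V b - V a \<le> M)"

lemma majorantD: "majorant V f a b \<Longrightarrow> a \<le> x \<Longrightarrow> x \<le> y \<Longrightarrow> y \<le> b \<Longrightarrow> \<bar>f y - f x\<bar> \<le> V y - V x"
  by (auto simp: majorant_def)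

lemma majorant_mono:
  assumes "majorant V f a b" "a \<le> x" "x \<le> y" "y \<le> b" shows "V x \<le> V y"
  using majorantD[OF assms] by linarith

lemma majorant_subset: "majorant V f a b \<Longrightarrow> a \<le> c \<Longrightarrow> d \<le> b \<Longrightarrow> majorant V f c d"
  by (auto simp: majorant_def)

lemma majorant_oscillation:
  assumes "majorant V f a b" "x \<in> {a..b}" "y \<in> {a..b}"
  shows "\<bar>f y - f x\<bar> \<le> V b - V a"
proof (cases "x \<le> y")
  case True
  then show ?thesis
    using majorantD[of V f a b x y] majorant_mono[of V f a b a x] majorant_mono[of V f a b y b] assms
    by auto
next
  case False
  then show ?thesis
    using majorantD[of V f a b y x] majorant_mono[of V f a b a y] majorant_mono[of V f a b x b] assms
    by auto
qed

lemma var_le_subset: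
  assumes "var_le f a b M" "a \<le> c" "c \<le> d" "d \<le> b" shows "var_le f c d M"
proof -
  obtain V where V: "majorant V f a b" "V b - V a \<le> M" using assms(1) by (auto simp: var_le_def)
  show ?thesis unfolding var_le_def
    using majorant_subset[OF V(1), of c d] V(2) majorant_mono[OF V(1), of a c]
      majorant_mono[OF V(1), of d b] assms
    by (intro exI[of _ V]) linarith
qed

lemma var_le_weaken: "var_le f a b M \<Longrightarrow> M \<le> M' \<Longrightarrow> var_le f a b M'"
  unfolding var_le_def by (meson order_trans)

lemma var_le_oscillation:
  assumes "var_le f a b M" "x \<in> {a..b}" "y \<in> {a..b}" shows "\<bar>f y - f x\<bar> \<le> M"
  using assms majorant_oscillation[of _ f a b x y] unfolding var_le_def by fastforce

lemma var_le_bounded: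
  assumes "var_le f a b M" "x \<in> {a..b}" shows "\<bar>f x\<bar> \<le> \<bar>f a\<bar> + M"
  using var_le_oscillation[of f a b M a x] assms by auto

lemma var_le_cong:
  assumes "\<And>x. x \<in> {a..b} \<Longrightarrow> f x = g x" "var_le f a b M" shows "var_le g a b M"
proof -
  have "majorant V g a b" if "majorant V f a b" for V
    unfolding majorant_def
  proof (intro allI impI)
    fix x y assume xy: "a \<le> x" "x \<le> y" "y \<le> b"
    then have "f x = g x" "f y = g y" using assms(1)[of x] assms(1)[of y] by auto
    then show "\<bar>g y - g x\<bar> \<le> V y - V x" using majorantD[OF that xy] by simp
  qed
  then show ?thesis using assms(2) unfolding var_le_def by blast
qed

lemma var_le_const: "0 \<le> M \<Longrightarrow> var_le (\<lambda>x. c) a b M"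
  unfolding var_le_def majorant_def by (rule exI[of _ "\<lambda>x. 0"]) auto

lemma var_le_add:
  assumes "var_le f a b M" "var_le g a b N" shows "var_le (\<lambda>x. f x + g x) a b (M + N)"
proof -
  obtain V W where V: "majorant V f a b" "V b - V a \<le> M" and W: "majorant W g a b" "W b - W a \<le> N"
    using assms by (auto simp: var_le_def)
  have "majorant (\<lambda>x. V x + W x) (\<lambda>x. f x + g x) a b"
    unfolding majorant_def using majorantD[OF V(1)] majorantD[OF W(1)] by (smt (verit, best))
  then show ?thesis unfolding var_le_def using V W by (intro exI[of _ "\<lambda>x. V x + W x"]) auto
qed

lemma var_le_sum:
  assumes "\<And>i. i \<in> I \<Longrightarrow> var_le (f i) a b (M i)" "finite I"
  shows "var_le (\<lambda>x. \<Sum>i\<in>I. f i x) a b (\<Sum>i\<in>I. M i)"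
  using assms(2,1)
  by (induction I rule: finite_induct) (auto intro: var_le_const var_le_add)

lemma var_le_scale:
  assumes "var_le f a b M" shows "var_le (\<lambda>x. c * f x) a b (\<bar>c\<bar> * M)"
proof -
  obtain V where V: "majorant V f a b" "V b - V a \<le> M" using assms by (auto simp: var_le_def)
  have "majorant (\<lambda>x. \<bar>c\<bar> * V x) (\<lambda>x. c * f x) a b"
    unfolding majorant_def
  proof (intro allI impI)
    fix x y assume xy: "a \<le> x" "x \<le> y" "y \<le> b"
    have "\<bar>c * f y - c * f x\<bar> = \<bar>c\<bar> * \<bar>f y - f x\<bar>" by (simp add: abs_mult[symmetric] algebra_simps)
    also have "\<dots> \<le> \<bar>c\<bar> * (V y - V x)" by (intro mult_left_mono majorantD[OF V(1) xy]) auto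
    finally show "\<bar>c * f y - c * f x\<bar> \<le> \<bar>c\<bar> * V y - \<bar>c\<bar> * V x" by (simp add: algebra_simps)
  qed
  moreover have "\<bar>c\<bar> * V b - \<bar>c\<bar> * V a \<le> \<bar>c\<bar> * M"
    using mult_left_mono[OF V(2), of "\<bar>c\<bar>"] by (simp add: algebra_simps)
  ultimately show ?thesis unfolding var_le_def by (intro exI[of _ "\<lambda>x. \<bar>c\<bar> * V x"]) auto
qed

lemma var_le_append:
  assumes "var_le f a b M" "var_le f b c N" "a \<le> b" "b \<le> c" shows "var_le f a c (M + N)"
proof -
  obtain V W where V: "majorant V f a b" "V b - V a \<le> M" and W: "majorant W f b c" "W c - W b \<le> N"
    using assms by (auto simp: var_le_def)
  define U where "U = (\<lambda>x. if x \<le> b then V x - V b else W x - W b)"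
  have "majorant U f a c" unfolding majorant_def
  proof (intro allI impI)
    fix x y assume xy: "a \<le> x" "x \<le> y" "y \<le> c"
    consider "y \<le> b" | "x \<le> b" "b < y" | "b < x" using xy by linarith
    then show "\<bar>f y - f x\<bar> \<le> U y - U x"
    proof cases
      case 1 then show ?thesis using majorantD[OF V(1), of x y] xy by (auto simp: U_def)
    next
      case 2 then show ?thesis
        using majorantD[OF V(1), of x b] majorantD[OF W(1), of b y] xy by (auto simp: U_def)
    next
      case 3 then show ?thesis using majorantD[OF W(1), of x y] xy by (auto simp: U_def)
    qed
  qed
  moreover have "U c - U a \<le> M + N" using V W assms(3,4) by (auto simp: U_def)
  ultimately show ?thesis unfolding var_le_def by blast
qed

lemma var_le_partition:
  assumes "\<And>j. j < n \<Longrightarrow> var_le f (t j) (t (Suc j)) (m j)" "\<And>j. t j \<le> t (Suc j)"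
  shows "var_le f (t 0) (t n) (\<Sum>j<n. m j)"
  using assms(1)
proof (induction n)
  case 0
  have "majorant (\<lambda>x. 0) f (t 0) (t 0)" unfolding majorant_def
  proof (intro allI impI)
    fix x y assume "t 0 \<le> x" "x \<le> y" "y \<le> t 0"
    then have "x = t 0" "y = t 0" by linarith+
    then show "\<bar>f y - f x\<bar> \<le> 0 - 0" by simp
  qed
  then show ?case unfolding var_le_def by (intro exI[where x = "\<lambda>x. 0"]) simp
next
  case (Suc n)
  have "t 0 \<le> t n" by (rule lift_Suc_mono_le[of t]) (use assms(2) in auto)
  then show ?case
    using var_le_append[of f "t 0" "t n" "\<Sum>j<n. m j" "t (Suc n)" "m n"] Suc assms(2)[of n] by simp
qed

lemma var_le_mult:
  assumes "var_le f a b M" "var_le g a b N"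
    and "\<And>x. x \<in> {a..b} \<Longrightarrow> \<bar>f x\<bar> \<le> F" "\<And>x. x \<in> {a..b} \<Longrightarrow> \<bar>g x\<bar> \<le> G" and "a \<le> b"
  shows "var_le (\<lambda>x. f x * g x) a b (F * N + G * M)"
proof -
  obtain V W where V: "majorant V f a b" "V b - V a \<le> M" and W: "majorant W g a b" "W b - W a \<le> N"
    using assms by (auto simp: var_le_def)
  have FG: "0 \<le> F" "0 \<le> G" using assms(3)[of a] assms(4)[of a] assms(5) by auto
  define U where "U = (\<lambda>x. F * W x + G * V x)"
  have "majorant U (\<lambda>x. f x * g x) a b" unfolding majorant_def
  proof (intro allI impI)
    fix x y assume xy: "a \<le> x" "x \<le> y" "y \<le> b"
    have "f y * g y - f x * g x = f y * (g y - g x) + (f y - f x) * g x" by (simp add: algebra_simps)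
    then have "\<bar>f y * g y - f x * g x\<bar> \<le> \<bar>f y\<bar> * \<bar>g y - g x\<bar> + \<bar>f y - f x\<bar> * \<bar>g x\<bar>"
      by (metis abs_mult abs_triangle_ineq)
    also have "\<dots> \<le> F * (W y - W x) + (V y - V x) * G"
      using majorantD[OF V(1) xy] majorantD[OF W(1) xy] assms(3)[of y] assms(4)[of x] xy FG
      by (intro add_mono mult_mono) auto
    finally show "\<bar>f y * g y - f x * g x\<bar> \<le> U y - U x" by (simp add: U_def algebra_simps)
  qed
  moreover have "U b - U a \<le> F * N + G * M"
    using mult_left_mono[OF V(2) FG(2)] mult_left_mono[OF W(2) FG(1)] by (simp add: U_def algebra_simps)
  ultimately show ?thesis unfolding var_le_def by blast
qed

lemma var_le_comp_mono:
  assumes "var_le f c d M" "mono_on {a..b} h" "h a = c" "h b = d"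
  shows "var_le (\<lambda>x. f (h x)) a b M"
proof -
  obtain V where V: "majorant V f c d" "V d - V c \<le> M" using assms by (auto simp: var_le_def)
  have "majorant (\<lambda>x. V (h x)) (\<lambda>x. f (h x)) a b" unfolding majorant_def
  proof (intro allI impI)
    fix x y assume xy: "a \<le> x" "x \<le> y" "y \<le> b"
    show "\<bar>f (h y) - f (h x)\<bar> \<le> V (h y) - V (h x)"
      by (rule majorantD[OF V(1)])
        (use mono_onD[OF assms(2), of a x] mono_onD[OF assms(2), of x y]
           mono_onD[OF assms(2), of y b] xy assms(3,4) in auto)
  qed
  then show ?thesis unfolding var_le_def using V(2) assms(3,4) by (intro exI[of _ "\<lambda>x. V (h x)"]) auto
qed

lemma var_le_comp_antimono:
  assumes "var_le f c d M" "antimono_on {a..b} h" "h a = d" "h b = c"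
  shows "var_le (\<lambda>x. f (h x)) a b M"
proof -
  obtain V where V: "majorant V f c d" "V d - V c \<le> M" using assms by (auto simp: var_le_def)
  have anti: "h y \<le> h x" if "a \<le> x" "x \<le> y" "y \<le> b" for x y
    using monotone_onD[OF assms(2), of x y] that by auto
  have "majorant (\<lambda>x. - V (h x)) (\<lambda>x. f (h x)) a b" unfolding majorant_def
  proof (intro allI impI)
    fix x y assume xy: "a \<le> x" "x \<le> y" "y \<le> b"
    have "\<bar>f (h x) - f (h y)\<bar> \<le> V (h x) - V (h y)"
      by (rule majorantD[OF V(1)])
        (use anti[of a x] anti[of x y] anti[of y b] xy assms(3,4) in auto)
    then show "\<bar>f (h y) - f (h x)\<bar> \<le> - V (h y) - - V (h x)" by simp
  qed
  then show ?thesis unfolding var_le_def using V(2) assms(3,4) by (intro exI[of _ "\<lambda>x. - V (h x)"]) auto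
qed

lemma var_le_mono:
  assumes "mono_on {a..b} f" shows "var_le f a b (f b - f a)"
  unfolding var_le_def majorant_def
  by (rule exI[of _ f]) (use mono_onD[OF assms] in auto)

lemma var_le_abs:
  assumes "var_le f a b M" shows "var_le (\<lambda>x. \<bar>f x\<bar>) a b M"
proof -
  obtain V where V: "majorant V f a b" "V b - V a \<le> M" using assms by (auto simp: var_le_def)
  have "majorant V (\<lambda>x. \<bar>f x\<bar>) a b"
    unfolding majorant_def using majorantD[OF V(1)] by (smt (verit, best))
  then show ?thesis using V(2) by (auto simp: var_le_def)
qed

text \<open>The Jordan decomposition, with the bounds that Helly's theorem needs.\<close>
lemma var_le_monotone_diff:
  assumes "var_le f a b M"
  obtains u w where "mono_on {a..b} u" "mono_on {a..b} w" "\<And>x. f x = u x - w x"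
    "u a = f a" "w a = 0" "w b \<le> M" "\<And>x. x \<in> {a..b} \<Longrightarrow> u x \<le> f a + 2 * M"
proof -
  obtain V where V: "majorant V f a b" "V b - V a \<le> M" using assms by (auto simp: var_le_def)
  define w where "w = (\<lambda>x. V x - V a)"
  define u where "u = (\<lambda>x. f x + w x)"
  have w: "mono_on {a..b} w"
    by (intro mono_onI) (use majorant_mono[OF V(1)] in \<open>auto simp: w_def\<close>)
  have u: "mono_on {a..b} u"
  proof (intro mono_onI)
    fix x y assume "x \<in> {a..b}" "y \<in> {a..b}" "x \<le> y"
    then have "\<bar>f y - f x\<bar> \<le> V y - V x" using majorantD[OF V(1), of x y] by auto
    then show "u x \<le> u y" by (simp add: u_def w_def)
  qed
  have "u x \<le> f a + 2 * M" if "x \<in> {a..b}" for x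
  proof -
    have "\<bar>f x - f a\<bar> \<le> M" using var_le_oscillation[OF assms, of a x] that by auto
    moreover have "w x \<le> M" using mono_onD[OF w, of x b] V(2) that by (auto simp: w_def)
    ultimately show ?thesis by (auto simp: u_def)
  qed
  then show ?thesis by (intro that[of u w] w u) (use V(2) in \<open>auto simp: u_def w_def\<close>)
qed

lemma var_le_measurable:
  assumes "var_le f 0 1 M" shows "f \<in> borel_measurable leb01"
proof -
  obtain u w where uw: "mono_on {0..1} u" "mono_on {0..1} w" and f: "\<And>x. f x = u x - w x"
    using var_le_monotone_diff[OF assms] by metis
  have "u \<in> borel_measurable leb01" "w \<in> borel_measurable leb01"
    using borel_measurable_mono_on_fnc[OF uw(1)] borel_measurable_mono_on_fnc[OF uw(2)]
    by (simp_all add: measurable_def sets_restrict_space space_restrict_space)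
  then show ?thesis using f by (simp add: f borel_measurable_diff cong: measurable_cong)
qed

lemma finite_measure_leb01: "finite_measure leb01"
  by (rule finite_measureI) (simp add: emeasure_restrict_space space_restrict_space)

lemma var_le_integrable:
  assumes "var_le f 0 1 M" shows "integrable leb01 f"
proof (rule finite_measure.integrable_const_bound[OF finite_measure_leb01, of _ "\<bar>f 0\<bar> + M"])
  show "AE x in leb01. norm (f x) \<le> \<bar>f 0\<bar> + M"
    by (rule AE_I2) (use var_le_bounded[OF assms] in \<open>auto simp: space_restrict_space\<close>)
  show "f \<in> borel_measurable leb01" by (rule var_le_measurable[OF assms])
qed

text \<open>Helly's selection theorem without right-continuity.  It is applied to the right-continuous versions of
the given functions, which differ from them only at the countably many points of discontinuity.\<close>
lemma Helly_monotone:
  fixes a :: "nat \<Rightarrow> real \<Rightarrow> real"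
  assumes mono: "\<And>n. mono_on {0..1} (a n)" and bd: "\<And>n x. x \<in> {0..1} \<Longrightarrow> \<bar>a n x\<bar> \<le> L"
  shows "\<exists>r g. strict_mono r \<and> (AE x in leb01. (\<lambda>n. a (r n) x) \<longlonglongrightarrow> g x)"
proof -
  \<comment> \<open>monotone extension to the whole line\<close>
  define b where "b = (\<lambda>n x. a n (max 0 (min 1 x)))"
  have b_mono: "mono (b n)" for n
    unfolding b_def by (intro monoI mono_onD[OF mono]) auto
  have b_bd: "\<bar>b n x\<bar> \<le> L" for n x unfolding b_def by (intro bd) auto
  \<comment> \<open>the right limit of \<open>b n\<close>\<close>
  define c where "c = (\<lambda>n x. Inf (b n ` {x<..}))"
  have bddb: "bdd_below (b n ` A)" for n A
    by (rule bdd_belowI[of _ "-L"]) (use b_bd in \<open>auto simp: abs_le_iff minus_le_iff\<close>)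
  have c_le: "c n x \<le> b n y" if "x < y" for n x y
    unfolding c_def by (rule cInf_lower) (use that bddb in auto)
  have c_ge: "z \<le> c n x" if "\<And>y. x < y \<Longrightarrow> z \<le> b n y" for n x z
    unfolding c_def using that by (intro cInf_greatest) (auto simp: gt_ex)
  have c_mono: "mono (c n)" for n
    by (intro monoI c_ge c_le) auto
  have b_le_c: "b n x \<le> c n x" for n x
    by (intro c_ge monoD[OF b_mono]) auto
  have c_bd: "\<bar>c n x\<bar> \<le> L" for n x
    using b_le_c[of n x] c_le[of x "x+1" n] b_bd[of n x] b_bd[of n "x+1"] by auto
  have c_right: "continuous (at_right x) (c n)" for n x
  proof -
    have "\<exists>d>0. c n (x + d) - c n x < e" if "e > 0" for e
    proof -
      have "\<exists>z>x. b n z < c n x + e"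
        using c_ge[of x "c n x + e" n] that by (meson add_le_same_cancel1 linorder_not_less)
      then obtain z where z: "x < z" "b n z < c n x + e" by blast
      have "c n (x + (z - x)/2) \<le> b n z" using z by (intro c_le) (auto simp: field_simps)
      with z show ?thesis by (intro exI[of _ "(z - x)/2"]) auto
    qed
    then show ?thesis
      by (subst continuous_at_right_real_increasing) (use monoD[OF c_mono] in auto)
  qed
  obtain s F where s: "strict_mono s" and F: "mono F"
    "\<And>x. continuous (at x) F \<Longrightarrow> (\<lambda>n. c (s n) x) \<longlonglongrightarrow> F x"
    using Helly_selection[of c L, OF c_right c_mono c_bd] by blast
  have eq: "c n x = b n x" if "isCont (b n) x" for n x
  proof (rule antisym[OF _ b_le_c])
    have "(b n \<longlongrightarrow> b n x) (at_right x)"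
      using that by (meson continuous_at filterlim_at_split)
    moreover have "eventually (\<lambda>y. c n x \<le> b n y) (at_right x)"
      using c_le by (auto simp: eventually_at_filter)
    ultimately show "c n x \<le> b n x"
      by (intro tendsto_lowerbound[of "b n" _ "at_right x"]) auto
  qed
  define X where "X = {x. \<not> isCont F x} \<union> (\<Union>n. {x. \<not> isCont (b n) x})"
  have "countable X" unfolding X_def
    using mono_ctble_discont[OF F(1)] mono_ctble_discont[OF b_mono] by auto
  then have "AE x in lborel. x \<notin> X"
    by (metis AE_not_in countable_imp_null_set_lborel)
  moreover have "(\<lambda>n. a (s n) x) \<longlonglongrightarrow> F x" if "x \<notin> X" "x \<in> {0..1}" for x
  proof -
    have "c (s n) x = a (s n) x" for n
      using eq[where n = "s n" and x = x] that by (auto simp: X_def b_def)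
    then show ?thesis using F(2)[of x] that by (simp add: X_def)
  qed
  ultimately have "AE x in leb01. (\<lambda>n. a (s n) x) \<longlonglongrightarrow> F x"
    by (subst AE_restrict_space_iff) (auto elim!: eventually_mono)
  with s show ?thesis by blast
qed

lemma Helly_bounded_variation:
  fixes f :: "nat \<Rightarrow> real \<Rightarrow> real"
  assumes var: "\<And>n. var_le (f n) 0 1 M" and bd: "\<And>n. \<bar>f n 0\<bar> \<le> L"
  shows "\<exists>r g. strict_mono r \<and> (AE x in leb01. (\<lambda>n. f (r n) x) \<longlonglongrightarrow> g x)"
proof -
  have "\<forall>n. \<exists>u w. mono_on {0..1} u \<and> mono_on {0..1} w \<and> (\<forall>x. f n x = u x - w x) \<and>
      u 0 = f n 0 \<and> w 0 = 0 \<and> w 1 \<le> M \<and> (\<forall>x\<in>{0..1}. u x \<le> f n 0 + 2 * M)"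
    using var_le_monotone_diff[OF var] by metis
  then obtain u w where uw: "\<And>n. mono_on {0..1} (u n)" "\<And>n. mono_on {0..1} (w n)"
    "\<And>n x. f n x = u n x - w n x" "\<And>n. u n 0 = f n 0" "\<And>n. w n 0 = 0" "\<And>n. w n 1 \<le> M"
    "\<And>n x. x \<in> {0..1} \<Longrightarrow> u n x \<le> f n 0 + 2 * M" by metis
  have M: "0 \<le> M" using mono_onD[OF uw(2), of 0 1 0] uw(5,6)[of 0] by auto
  have u_bd: "\<bar>u n x\<bar> \<le> L + 2 * M" if "x \<in> {0..1}" for n x
    using uw(7)[OF that, of n] mono_onD[OF uw(1), of 0 x n] bd[of n] uw(4)[of n] that M by auto
  have w_bd: "\<bar>w n x\<bar> \<le> M" if "x \<in> {0..1}" for n x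
    using mono_onD[OF uw(2), of 0 x n] mono_onD[OF uw(2), of x 1 n] uw(5,6)[of n] that by auto
  obtain r g where r: "strict_mono r" "AE x in leb01. (\<lambda>n. u (r n) x) \<longlonglongrightarrow> g x"
    using Helly_monotone[of u, OF uw(1) u_bd] by blast
  obtain s h where s: "strict_mono s" "AE x in leb01. (\<lambda>n. w (r (s n)) x) \<longlonglongrightarrow> h x"
    using Helly_monotone[of "\<lambda>n. w (r n)", OF uw(2) w_bd] by blast
  have "AE x in leb01. (\<lambda>n. f (r (s n)) x) \<longlonglongrightarrow> g x - h x"
    using r(2) s(2)
  proof eventually_elim
    case (elim x)
    have "(\<lambda>n. u (r (s n)) x) \<longlonglongrightarrow> g x"
      using LIMSEQ_subseq_LIMSEQ[OF elim(1) s(1)] by (simp add: o_def)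
    then show ?case using elim(2) uw(3) by (auto intro: tendsto_diff)
  qed
  then have "AE x in leb01. (\<lambda>n. f ((r \<circ> s) n) x) \<longlonglongrightarrow> g x - h x" by (simp add: o_def)
  with strict_mono_o[OF r(1) s(1)]
  have "strict_mono (r \<circ> s) \<and> (AE x in leb01. (\<lambda>n. f ((r \<circ> s) n) x) \<longlonglongrightarrow> g x - h x)" by blast
  then show ?thesis by (intro exI)
qed

section \<open>Cusp maps with two full branches and their transfer operator\<close>

lemma leb01_integral_eq:
  fixes g :: "real \<Rightarrow> real"
  assumes "integrable leb01 g"
  shows "g absolutely_integrable_on {0..1}" "(LINT x|leb01. g x) = integral {0..1} g"
proof -
  have 1: "set_integrable lborel {0..1} g"
    using assms by (simp add: set_integrable_def integrable_restrict_space)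
  show "g absolutely_integrable_on {0..1}"
    using 1 unfolding set_integrable_def by (subst integrable_completion) (auto dest: borel_measurable_integrable)
  show "(LINT x|leb01. g x) = integral {0..1} g"
    using set_borel_integral_eq_integral(2)[OF 1]
    by (simp add: integral_restrict_space set_lebesgue_integral_def)
qed

lemma integrable_leb01_bounded_mult:
  fixes f \<phi> :: "real \<Rightarrow> real"
  assumes "\<phi> \<in> borel_measurable leb01" "\<And>x. x \<in> {0..1} \<Longrightarrow> \<bar>\<phi> x\<bar> \<le> B" "integrable leb01 f"
  shows "integrable leb01 (\<lambda>x. \<phi> x * f x)"
proof (rule Bochner_Integration.integrable_bound[of _ "\<lambda>x. B * f x"])
  show "integrable leb01 (\<lambda>x. B * f x)" using assms(3) by simp
  show "(\<lambda>x. \<phi> x * f x) \<in> borel_measurable leb01" using assms(1,3) by measurable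
  show "AE x in leb01. norm (\<phi> x * f x) \<le> norm (B * f x)"
  proof (rule AE_I2)
    fix x assume "x \<in> space leb01"
    then have "\<bar>\<phi> x\<bar> \<le> \<bar>B\<bar>" using assms(2)[of x] by (auto simp: space_restrict_space)
    then show "norm (\<phi> x * f x) \<le> norm (B * f x)" by (auto simp: abs_mult intro: mult_right_mono)
  qed
qed

text \<open>A map \<open>S\<close> of \<open>{0..1}\<close> with an increasing full branch on \<open>{0..c}\<close> and a decreasing full branch on \<open>{c..1}\<close>,
together with a nondecreasing function \<open>v\<close> that equals \<open>- 1 / S'\<close> away from the cusp and the end points
and vanishes at the cusp.  Its monotonicity is the only trace of the convexity of the branches that the
variation estimates need.\<close>
locale cusp_system =
  fixes S :: "real \<Rightarrow> real" and c :: real and v :: "real \<Rightarrow> real"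
  assumes c: "0 < c" "c < 1"
    and inc: "strict_mono_on {0..c} S" and dec: "strict_antimono_on {c..1} S"
    and cont: "continuous_on {0..1} S"
    and S0: "S 0 = 0" and Sc: "S c = 1" and S1: "S 1 = 0"
    and v_mono: "mono_on {0..1} v" and v_c: "v c = 0"
    and v_neg: "\<And>z. 0 \<le> z \<Longrightarrow> z < c \<Longrightarrow> v z < 0"
    and v_pos: "\<And>z. c < z \<Longrightarrow> z \<le> 1 \<Longrightarrow> 0 < v z"
    and deriv: "\<And>z. 0 < z \<Longrightarrow> z < 1 \<Longrightarrow> z \<noteq> c \<Longrightarrow> (S has_real_derivative (- 1 / v z)) (at z)"
begin

abbreviation "h1 \<equiv> inv1 S c"
abbreviation "h2 \<equiv> inv2 S c"

lemma inc_less_iff: "x \<in> {0..c} \<Longrightarrow> y \<in> {0..c} \<Longrightarrow> S x < S y \<longleftrightarrow> x < y"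
  using strict_mono_on_less[OF inc] by auto

lemma dec_less_iff: "x \<in> {c..1} \<Longrightarrow> y \<in> {c..1} \<Longrightarrow> S x < S y \<longleftrightarrow> y < x"
  using monotone_onD[OF dec, of x y] monotone_onD[OF dec, of y x]
  by (cases x y rule: linorder_cases) auto

lemma inc_le_iff: "x \<in> {0..c} \<Longrightarrow> y \<in> {0..c} \<Longrightarrow> S x \<le> S y \<longleftrightarrow> x \<le> y"
  using inc_less_iff[of y x] by auto

lemma dec_le_iff: "x \<in> {c..1} \<Longrightarrow> y \<in> {c..1} \<Longrightarrow> S x \<le> S y \<longleftrightarrow> y \<le> x"
  using dec_less_iff[of y x] by auto

lemma S_in: assumes "x \<in> {0..1}" shows "S x \<in> {0..1}"
proof (cases "x \<le> c")
  case True
  then show ?thesis using inc_le_iff[of 0 x] inc_le_iff[of x c] assms c S0 Sc by auto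
next
  case False
  then show ?thesis using dec_le_iff[of 1 x] dec_le_iff[of x c] assms c S1 Sc by auto
qed

lemma image1: "S ` {0..c} = {0..1}"
proof (intro equalityI subsetI)
  fix y :: real assume y: "y \<in> {0..1}"
  have "continuous_on {0..c} S" using c by (intro continuous_on_subset[OF cont]) auto
  then obtain x where "0 \<le> x" "x \<le> c" "S x = y" using IVT'[of S 0 y c] y c S0 Sc by auto
  then show "y \<in> S ` {0..c}" by auto
next
  fix y assume "y \<in> S ` {0..c}"
  then obtain x where "x \<in> {0..c}" "y = S x" by blast
  then show "y \<in> {0..1}" using S_in[of x] c by auto
qed

lemma image2: "S ` {c..1} = {0..1}"
proof (intro equalityI subsetI)
  fix y :: real assume y: "y \<in> {0..1}"
  have "continuous_on {c..1} S" using c by (intro continuous_on_subset[OF cont]) auto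
  then obtain x where "c \<le> x" "x \<le> 1" "S x = y" using IVT2'[of S 1 y c] y c S1 Sc by auto
  then show "y \<in> S ` {c..1}" by auto
next
  fix y assume "y \<in> S ` {c..1}"
  then obtain x where "x \<in> {c..1}" "y = S x" by blast
  then show "y \<in> {0..1}" using S_in[of x] c by auto
qed

lemma inj1: "inj_on S {0..c}"
  using inc by (rule strict_mono_on_imp_inj_on)

lemma inj2: "inj_on S {c..1}"
proof (rule inj_onI)
  fix x y assume "x \<in> {c..1}" "y \<in> {c..1}" "S x = S y"
  then show "x = y" using dec_less_iff[of x y] dec_less_iff[of y x] by auto
qed

lemma h1_in: "y \<in> {0..1} \<Longrightarrow> h1 y \<in> {0..c}" and S_h1: "y \<in> {0..1} \<Longrightarrow> S (h1 y) = y"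
  using inv_into_into[of y S "{0..c}"] f_inv_into_f[of y S "{0..c}"] image1 by (auto simp: inv1_def)

lemma h2_in: "y \<in> {0..1} \<Longrightarrow> h2 y \<in> {c..1}" and S_h2: "y \<in> {0..1} \<Longrightarrow> S (h2 y) = y"
  using inv_into_into[of y S "{c..1}"] f_inv_into_f[of y S "{c..1}"] image2 by (auto simp: inv2_def)

lemma h1_S: "x \<in> {0..c} \<Longrightarrow> h1 (S x) = x"
  unfolding inv1_def by (rule inv_into_f_f[OF inj1])

lemma h2_S: "x \<in> {c..1} \<Longrightarrow> h2 (S x) = x"
  unfolding inv2_def by (rule inv_into_f_f[OF inj2])

lemma h_in: assumes "y \<in> {0..1}" shows "h1 y \<in> {0..1}" "h2 y \<in> {0..1}"
  using h1_in[OF assms] h2_in[OF assms] c by auto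

lemma h1_ends: "h1 0 = 0" "h1 1 = c" and h2_ends: "h2 0 = 1" "h2 1 = c"
  using h1_S[of 0] h1_S[of c] h2_S[of 1] h2_S[of c] c S0 Sc S1 by auto

lemma h1_mono: "mono_on {0..1} h1"
proof (rule mono_onI)
  fix x y :: real assume "x \<in> {0..1}" "y \<in> {0..1}" "x \<le> y"
  then show "h1 x \<le> h1 y" using inc_le_iff[of "h1 x" "h1 y"] h1_in S_h1 by simp
qed

lemma h2_antimono: "antimono_on {0..1} h2"
proof (rule monotone_onI)
  fix x y :: real assume "x \<in> {0..1}" "y \<in> {0..1}" "x \<le> y"
  then show "h2 y \<le> h2 x" using dec_le_iff[of "h2 x" "h2 y"] h2_in S_h2 by simp
qed

text \<open>The sum of \<open>u\<close> over the two preimages of a point, and the transfer operator.  Both are meaningful on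
\<open>{0..1}\<close> only.\<close>
definition fibre_sum :: "(real \<Rightarrow> real) \<Rightarrow> real \<Rightarrow> real" where
  "fibre_sum u y = u (h1 y) + u (h2 y)"

definition transfer :: "(real \<Rightarrow> real) \<Rightarrow> real \<Rightarrow> real" where
  "transfer f = fibre_sum (\<lambda>z. \<bar>v z\<bar> * f z)"

text \<open>\<open>contraction n z\<close> is the reciprocal of the absolute value of the derivative of \<open>S ^^ n\<close> at \<open>z\<close>, and 0 if
the orbit of \<open>z\<close> meets the cusp before time \<open>n\<close>.\<close>
fun contraction :: "nat \<Rightarrow> real \<Rightarrow> real" where
  "contraction 0 z = 1"
| "contraction (Suc n) z = \<bar>v z\<bar> * contraction n (S z)"

lemma fibre_sum_var:
  assumes "var_le u 0 1 M" shows "var_le (fibre_sum u) 0 1 M"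
proof -
  obtain V where V: "majorant V u 0 1" "V 1 - V 0 \<le> M" using assms by (auto simp: var_le_def)
  have "var_le u 0 c (V c - V 0)" "var_le u c 1 (V 1 - V c)"
    unfolding var_le_def using majorant_subset[OF V(1), of 0 c] majorant_subset[OF V(1), of c 1] c by auto
  then have "var_le (\<lambda>y. u (h1 y) + u (h2 y)) 0 1 ((V c - V 0) + (V 1 - V c))"
    by (intro var_le_add var_le_comp_mono[OF _ h1_mono] var_le_comp_antimono[OF _ h2_antimono])
      (auto simp: h1_ends h2_ends)
  then have "var_le (fibre_sum u) 0 1 ((V c - V 0) + (V 1 - V c))"
    by (simp add: fibre_sum_def[abs_def])
  then show ?thesis by (rule var_le_weaken) (use V in auto)
qed

lemma v_bounded: "z \<in> {0..1} \<Longrightarrow> \<bar>v z\<bar> \<le> max \<bar>v 0\<bar> \<bar>v 1\<bar>"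
  using mono_onD[OF v_mono, of 0 z] mono_onD[OF v_mono, of z 1] by auto

lemma abs_v_var: "var_le (\<lambda>z. \<bar>v z\<bar>) 0 1 (v 1 - v 0)"
  by (intro var_le_abs var_le_mono v_mono)

lemma transfer_bv:
  assumes "var_le f 0 1 M" shows "\<exists>M'. var_le (transfer f) 0 1 M'"
  unfolding transfer_def
  using fibre_sum_var[OF var_le_mult[OF abs_v_var assms, of "max \<bar>v 0\<bar> \<bar>v 1\<bar>" "\<bar>f 0\<bar> + M"]]
    v_bounded var_le_bounded[OF assms] by auto

lemma transfer_nonneg:
  assumes "\<And>x. x \<in> {0..1} \<Longrightarrow> 0 \<le> f x" "y \<in> {0..1}" shows "0 \<le> transfer f y"
  using assms h_in[OF assms(2)] by (auto simp: transfer_def fibre_sum_def)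

lemma S_measurable: "S \<in> borel_measurable leb01"
  using borel_measurable_continuous_on_restrict[OF cont]
  by (simp add: measurable_def sets_restrict_space space_restrict_space)

text \<open>Change of variables on each branch.  The functions on both sides are defined pointwise, not only almost
everywhere, so that variations make sense.\<close>
lemma transfer_duality:
  assumes f: "var_le f 0 1 M" and \<phi>: "\<phi> \<in> borel_measurable borel" "\<And>x. \<bar>\<phi> x\<bar> \<le> B"
  shows "(LINT x|leb01. \<phi> (S x) * f x) = (LINT y|leb01. \<phi> y * transfer f y)"
proof -
  define k where "k = (\<lambda>z. \<bar>v z\<bar> * f z)"
  obtain K where k: "var_le k 0 1 K"
    unfolding k_def using var_le_mult[OF abs_v_var f, of "max \<bar>v 0\<bar> \<bar>v 1\<bar>" "\<bar>f 0\<bar> + M"]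
      v_bounded var_le_bounded[OF f] by auto
  have \<phi>': "\<phi> \<in> borel_measurable leb01" using \<phi>(1) by (simp add: measurable_restrict_space1)
  have k1: "var_le (\<lambda>y. k (h1 y)) 0 1 K"
    by (rule var_le_comp_mono[OF var_le_subset[OF k, of 0 c] h1_mono]) (use c h1_ends in auto)
  have k2: "var_le (\<lambda>y. k (h2 y)) 0 1 K"
    by (rule var_le_comp_antimono[OF var_le_subset[OF k, of c 1] h2_antimono]) (use c h2_ends in auto)
  define F1 where "F1 = (\<lambda>y. \<phi> y * k (h1 y))"
  define F2 where "F2 = (\<lambda>y. \<phi> y * k (h2 y))"
  define G where "G = (\<lambda>x. \<phi> (S x) * f x)"
  have iF1: "integrable leb01 F1" and iF2: "integrable leb01 F2"
    unfolding F1_def F2_def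
    using var_le_integrable[OF k1] var_le_integrable[OF k2] \<phi>(2)
    by (auto intro!: integrable_leb01_bounded_mult[OF \<phi>', of B])
  have iG: "integrable leb01 G" unfolding G_def
    by (rule integrable_leb01_bounded_mult[OF _ _ var_le_integrable[OF f], of _ B])
      (use \<phi> measurable_compose[OF S_measurable \<phi>(1)] in auto)
  have open_closed: "integral {a<..<b} g = integral {a..b} g" for a b :: real and g :: "real \<Rightarrow> real"
    using integral_open_interval[of a b g] by simp
  have sub: "F absolutely_integrable_on {0<..<1}" if "integrable leb01 F" for F :: "real \<Rightarrow> real"
    by (rule set_integrable_subset[OF leb01_integral_eq(1)[OF that]]) auto
  have im1: "S ` {0<..<c} = {0<..<1}"
  proof (intro equalityI subsetI)
    fix y :: real assume y: "y \<in> {0<..<1}"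
    then have "h1 y \<in> {0..c}" "S (h1 y) = y" using h1_in[of y] S_h1[of y] by auto
    moreover from this have "h1 y \<noteq> 0" "h1 y \<noteq> c" using y S0 Sc by auto
    ultimately show "y \<in> S ` {0<..<c}" by (auto intro!: image_eqI[of _ _ "h1 y"])
  next
    fix y assume "y \<in> S ` {0<..<c}"
    then show "y \<in> {0<..<1}" using inc_less_iff[of 0] inc_less_iff[of _ c] S0 Sc c by auto
  qed
  have im2: "S ` {c<..<1} = {0<..<1}"
  proof (intro equalityI subsetI)
    fix y :: real assume y: "y \<in> {0<..<1}"
    then have "h2 y \<in> {c..1}" "S (h2 y) = y" using h2_in[of y] S_h2[of y] by auto
    moreover from this have "h2 y \<noteq> 1" "h2 y \<noteq> c" using y S1 Sc by auto
    ultimately show "y \<in> S ` {c<..<1}" by (auto intro!: image_eqI[of _ _ "h2 y"])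
  next
    fix y assume "y \<in> S ` {c<..<1}"
    then show "y \<in> {0<..<1}" using dec_less_iff[of 1] dec_less_iff[of _ c] S1 Sc c by auto
  qed
  have part1: "integral {0<..<c} G = integral {0<..<1} F1"
  proof -
    have "integral {0<..<c} (\<lambda>x. \<bar>- 1 / v x\<bar> * F1 (S x)) = integral (S ` {0<..<c}) F1"
    proof (rule conjunct2[OF has_absolute_integral_change_of_variables_1'
          [where g = S and g' = "\<lambda>x. - 1 / v x" and f = F1, THEN iffD2]])
      show "(S has_real_derivative (- 1 / v x)) (at x within {0<..<c})" if "x \<in> {0<..<c}" for x
        by (rule has_field_derivative_at_within, rule deriv) (use c that in auto)
      show "inj_on S {0<..<c}" by (rule inj_on_subset[OF inj1]) auto
      show "F1 absolutely_integrable_on S ` {0<..<c} \<and>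
        integral (S ` {0<..<c}) F1 = integral (S ` {0<..<c}) F1" using sub[OF iF1] im1 by simp
    qed auto
    moreover have "integral {0<..<c} (\<lambda>x. \<bar>- 1 / v x\<bar> * F1 (S x)) = integral {0<..<c} G"
    proof (rule integral_cong)
      fix x assume x: "x \<in> {0<..<c}"
      then show "\<bar>- 1 / v x\<bar> * F1 (S x) = G x"
        using v_neg[of x] h1_S[of x] by (simp add: F1_def G_def k_def)
    qed
    ultimately show ?thesis using im1 by simp
  qed
  have part2: "integral {c<..<1} G = integral {0<..<1} F2"
  proof -
    have "integral {c<..<1} (\<lambda>x. \<bar>- 1 / v x\<bar> * F2 (S x)) = integral (S ` {c<..<1}) F2"
    proof (rule conjunct2[OF has_absolute_integral_change_of_variables_1'
          [where g = S and g' = "\<lambda>x. - 1 / v x" and f = F2, THEN iffD2]])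
      show "(S has_real_derivative (- 1 / v x)) (at x within {c<..<1})" if "x \<in> {c<..<1}" for x
        by (rule has_field_derivative_at_within, rule deriv) (use c that in auto)
      show "inj_on S {c<..<1}" by (rule inj_on_subset[OF inj2]) auto
      show "F2 absolutely_integrable_on S ` {c<..<1} \<and>
        integral (S ` {c<..<1}) F2 = integral (S ` {c<..<1}) F2" using sub[OF iF2] im2 by simp
    qed auto
    moreover have "integral {c<..<1} (\<lambda>x. \<bar>- 1 / v x\<bar> * F2 (S x)) = integral {c<..<1} G"
    proof (rule integral_cong)
      fix x assume x: "x \<in> {c<..<1}"
      then show "\<bar>- 1 / v x\<bar> * F2 (S x) = G x"
        using v_pos[of x] h2_S[of x] by (simp add: F2_def G_def k_def)
    qed
    ultimately show ?thesis using im2 by simp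
  qed
  have "(LINT x|leb01. G x) = integral {0..1} G" by (rule leb01_integral_eq(2)[OF iG])
  also have "\<dots> = integral {0..c} G + integral {c..1} G"
    using Henstock_Kurzweil_Integration.integral_combine[of 0 c 1 G] c
      set_lebesgue_integral_eq_integral(1)[of "{0..1}" G] leb01_integral_eq(1)[OF iG] by simp
  also have "\<dots> = integral {0..1} F1 + integral {0..1} F2"
    using part1 part2 by (simp add: open_closed)
  also have "\<dots> = (LINT x|leb01. F1 x + F2 x)"
    using iF1 iF2 by (simp add: leb01_integral_eq(2))
  also have "\<dots> = (LINT y|leb01. \<phi> y * transfer f y)"
    by (simp add: F1_def F2_def transfer_def fibre_sum_def k_def algebra_simps)
  finally show ?thesis by (simp add: G_def)
qed

lemma transfer_integral:
  assumes "var_le f 0 1 M" shows "(LINT x|leb01. transfer f x) = (LINT x|leb01. f x)"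
  using transfer_duality[OF assms, of "\<lambda>x. 1" 1] by simp

lemma transfer_iterates:
  assumes f: "var_le f 0 1 M" "\<And>x. x \<in> {0..1} \<Longrightarrow> 0 \<le> f x"
  shows "(\<exists>M'. var_le ((transfer ^^ n) f) 0 1 M') \<and> (\<forall>x\<in>{0..1}. 0 \<le> (transfer ^^ n) f x) \<and>
    (LINT x|leb01. (transfer ^^ n) f x) = (LINT x|leb01. f x)"
proof (induction n)
  case (Suc n)
  then show ?case using transfer_bv transfer_nonneg transfer_integral by auto
qed (use assms in auto)

lemma fibre_sum_iterate_cong:
  assumes "\<And>x. x \<in> {0..1} \<Longrightarrow> u x = w x" "y \<in> {0..1}"
  shows "(fibre_sum ^^ n) u y = (fibre_sum ^^ n) w y"
  using assms(2)
proof (induction n arbitrary: y)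
  case (Suc n)
  then show ?case using h_in[OF Suc.prems] by (simp add: fibre_sum_def)
qed (use assms(1) in auto)

lemma transfer_iterate_eq:
  assumes "y \<in> {0..1}"
  shows "(transfer ^^ n) f y = (fibre_sum ^^ n) (\<lambda>z. contraction n z * f z) y"
proof (induction n arbitrary: f)
  case (Suc n)
  have "(transfer ^^ Suc n) f y = (transfer ^^ n) (transfer f) y"
    by (simp only: funpow_Suc_right comp_apply)
  also have "\<dots> = (fibre_sum ^^ n) (\<lambda>z. contraction n z * transfer f z) y" by (rule Suc)
  also have "\<dots> = (fibre_sum ^^ n) (fibre_sum (\<lambda>z. contraction (Suc n) z * f z)) y"
  proof (rule fibre_sum_iterate_cong[OF _ assms])
    fix x :: real assume "x \<in> {0..1}"
    then show "contraction n x * transfer f x = fibre_sum (\<lambda>z. contraction (Suc n) z * f z) x"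
      by (simp add: transfer_def fibre_sum_def S_h1 S_h2 algebra_simps)
  qed
  finally show ?case by (simp only: funpow_Suc_right comp_apply)
qed simp

lemma transfer_iterate_var:
  assumes "var_le (\<lambda>z. contraction n z * f z) 0 1 M"
  shows "var_le ((transfer ^^ n) f) 0 1 M"
proof -
  have "var_le ((fibre_sum ^^ n) (\<lambda>z. contraction n z * f z)) 0 1 M"
  proof -
    have "var_le ((fibre_sum ^^ m) (\<lambda>z. contraction n z * f z)) 0 1 M" for m
      by (induction m) (use assms fibre_sum_var in auto)
    then show ?thesis .
  qed
  then show ?thesis
    by (rule var_le_cong[rotated]) (simp add: transfer_iterate_eq)
qed

lemma contraction_nonneg: "0 \<le> contraction n z"
  by (induction n arbitrary: z) auto

lemma contraction_add: "contraction (m + n) z = contraction m z * contraction n ((S ^^ m) z)"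
  by (induction m arbitrary: z) (auto simp: funpow_swap1)

text \<open>On a cell of length \<open>1 / N\<close> a density is bounded by its variation on the cell plus \<open>N\<close> times its integral
over the cell, which is where the term without the variation of \<open>f\<close> comes from.\<close>
lemma Lasota_Yorke:
  assumes N: "0 < (N::nat)"
    and cell: "\<And>j. j < N \<Longrightarrow> var_le (contraction n) (real j / N) (real (Suc j) / N) \<delta>"
    and s: "\<And>z. z \<in> {0..1} \<Longrightarrow> contraction n z \<le> s"
    and f: "var_le f 0 1 M" "\<And>x. x \<in> {0..1} \<Longrightarrow> 0 \<le> f x" "(LINT x|leb01. f x) = 1"
  shows "var_le ((transfer ^^ n) f) 0 1 ((s + \<delta>) * M + \<delta> * N)"
proof -
  obtain V where V: "majorant V f 0 1" "V 1 - V 0 \<le> M" using f by (auto simp: var_le_def)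
  define t where "t = (\<lambda>j. real j / N)"
  define m where "m = (\<lambda>j. V (t (Suc j)) - V (t j))"
  define G where "G = (\<lambda>x. integral {0..x} f)"
  have t: "t j \<le> t (Suc j)" for j using N by (simp add: t_def divide_right_mono)
  have t1: "t (Suc j) \<le> 1" if "j < N" for j using that N by (simp add: t_def)
  have t0: "0 \<le> t j" for j using N by (simp add: t_def)
  have len: "t (Suc j) - t j = 1 / N" for j using N by (simp add: t_def field_simps)
  have fint: "f integrable_on {0..1}" and fI: "integral {0..1} f = 1"
    using leb01_integral_eq[OF var_le_integrable[OF f(1)]] f(3)
    by (auto simp: absolutely_integrable_on_def)
  have s0: "0 \<le> s" using s[of 0] contraction_nonneg[of n 0] by auto
  have "0 \<le> \<delta>" using var_le_oscillation[OF cell[of 0], of 0 0] N by auto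
  have M0: "0 \<le> m j" if "j < N" for j
    using majorant_mono[OF V(1), of "t j" "t (Suc j)"] t[of j] t1[OF that] t0[of j] by (auto simp: m_def)
  have sup: "f z \<le> m j + N * (G (t (Suc j)) - G (t j))" if "j < N" "z \<in> {t j..t (Suc j)}" for j z
  proof -
    have sub: "f integrable_on {t j..t (Suc j)}"
      by (rule integrable_subinterval_real[OF fint]) (use t1[OF that(1)] t0[of j] in auto)
    \<comment> \<open>average \<open>f z \<le> f x + m j\<close> over \<open>x\<close> in the cell\<close>
    have "integral {t j..t (Suc j)} (\<lambda>x. f z) \<le> integral {t j..t (Suc j)} (\<lambda>x. f x + m j)"
    proof (intro integral_le integrable_add sub)
      fix x assume x: "x \<in> {t j..t (Suc j)}"
      have "majorant V f (t j) (t (Suc j))"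
        by (rule majorant_subset[OF V(1)]) (use t1[OF that(1)] t0[of j] in auto)
      then have "\<bar>f z - f x\<bar> \<le> m j" unfolding m_def by (rule majorant_oscillation) (use x that in auto)
      then show "f z \<le> f x + m j" by auto
    qed auto
    also have "\<dots> = integral {t j..t (Suc j)} f + integral {t j..t (Suc j)} (\<lambda>x. m j)"
      by (intro Henstock_Kurzweil_Integration.integral_add sub) auto
    finally have "f z / N \<le> integral {t j..t (Suc j)} f + m j / N"
      using t[of j] len[of j] by simp
    moreover have "G (t j) + integral {t j..t (Suc j)} f = G (t (Suc j))"
      unfolding G_def
      by (rule Henstock_Kurzweil_Integration.integral_combine)
        (use t0[of j] t[of j] t1[OF that(1)] in \<open>auto intro!: integrable_subinterval_real[OF fint]\<close>)
    ultimately have "f z \<le> m j + N * integral {t j..t (Suc j)} f"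
      "integral {t j..t (Suc j)} f = G (t (Suc j)) - G (t j)"
      using N by (simp_all add: field_simps)
    then show ?thesis by simp
  qed
  have "var_le (\<lambda>z. contraction n z * f z) (t j) (t (Suc j))
      (s * m j + (m j + N * (G (t (Suc j)) - G (t j))) * \<delta>)" if "j < N" for j
  proof (rule var_le_mult)
    show "var_le (contraction n) (t j) (t (Suc j)) \<delta>" using cell[OF that] by (simp add: t_def)
    have "majorant V f (t j) (t (Suc j))"
      by (rule majorant_subset[OF V(1)]) (use t1[OF that] t0[of j] in auto)
    then show "var_le f (t j) (t (Suc j)) (m j)" by (auto simp: var_le_def m_def)
    show "\<bar>contraction n z\<bar> \<le> s" if "z \<in> {t j..t (Suc j)}" for z
      using s[of z] contraction_nonneg[of n z] that t0[of j] t1[OF \<open>j < N\<close>] by auto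
    show "\<bar>f z\<bar> \<le> m j + N * (G (t (Suc j)) - G (t j))" if "z \<in> {t j..t (Suc j)}" for z
      using sup[OF \<open>j < N\<close> that] f(2)[of z] that t0[of j] t1[OF \<open>j < N\<close>] by auto
  qed (rule t)
  then have "var_le (\<lambda>z. contraction n z * f z) (t 0) (t N)
      (\<Sum>j<N. s * m j + (m j + N * (G (t (Suc j)) - G (t j))) * \<delta>)"
    by (rule var_le_partition) (simp_all add: t)
  moreover have "(\<Sum>j<N. s * m j + (m j + N * (G (t (Suc j)) - G (t j))) * \<delta>)
     = (s + \<delta>) * (\<Sum>j<N. m j) + \<delta> * N * (\<Sum>j<N. G (t (Suc j)) - G (t j))"
    by (simp add: sum.distrib sum_subtractf sum_distrib_left algebra_simps)
  moreover have "(\<Sum>j<N. m j) = V 1 - V 0" "(\<Sum>j<N. G (t (Suc j)) - G (t j)) = 1"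
    unfolding m_def using sum_lessThan_telescope[of "\<lambda>j. V (t j)" N] sum_lessThan_telescope[of "\<lambda>j. G (t j)" N] N fI
    by (auto simp: t_def G_def)
  ultimately have "var_le (\<lambda>z. contraction n z * f z) 0 1 ((s + \<delta>) * (V 1 - V 0) + \<delta> * N)"
    using N by (simp add: t_def)
  then have "var_le (\<lambda>z. contraction n z * f z) 0 1 ((s + \<delta>) * M + \<delta> * N)"
    by (rule var_le_weaken) (use V s0 \<open>0 \<le> \<delta>\<close> in \<open>auto intro!: mult_left_mono\<close>)
  then show ?thesis by (rule transfer_iterate_var)
qed

end

section \<open>From uniformly bounded variation to convergence of the invariant densities\<close>

lemma prob_space_leb01: "prob_space leb01"
  by (rule prob_spaceI) (simp add: emeasure_restrict_space space_restrict_space)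

lemma emeasure_density_leb01:
  fixes g :: "real \<Rightarrow> real"
  assumes "g \<in> borel_measurable leb01"
  shows "emeasure (density leb01 (\<lambda>x. ennreal (g x))) (space leb01) = (\<integral>\<^sup>+x. ennreal (g x) \<partial>leb01)"
proof -
  have "emeasure (density leb01 (\<lambda>x. ennreal (g x))) (space leb01)
      = (\<integral>\<^sup>+x. ennreal (g x) * indicator (space leb01) x \<partial>leb01)"
    by (rule emeasure_density[OF _ sets.top]) (use assms in measurable)
  also have "\<dots> = (\<integral>\<^sup>+x. ennreal (g x) \<partial>leb01)"
    by (rule nn_integral_cong) auto
  finally show ?thesis .
qed

lemma density_integrable:
  assumes "unique_acip_density S \<rho>" shows "integrable leb01 \<rho>"
proof -
  obtain \<mu> where \<mu>: "acip S \<mu>" "\<rho> \<in> borel_measurable leb01" "AE x in leb01. 0 \<le> \<rho> x"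
    "\<mu> = density leb01 (\<lambda>x. ennreal (\<rho> x))" using assms by (auto simp: unique_acip_density_def)
  interpret prob_space \<mu> using \<mu>(1) by (auto simp: acip_def)
  have "(\<integral>\<^sup>+x. ennreal (\<rho> x) \<partial>leb01) = emeasure \<mu> (space \<mu>)"
    unfolding \<mu>(4) space_density by (rule emeasure_density_leb01[OF \<mu>(2), symmetric])
  then have "(\<integral>\<^sup>+x. ennreal (\<rho> x) \<partial>leb01) < \<infinity>" using emeasure_space_1 by simp
  then show ?thesis using \<mu>(2,3) by (auto intro: integrableI_nonneg)
qed

lemma var_le_density_bound:
  assumes f: "var_le f 0 1 M" "(LINT x|leb01. f x) = 1" and z: "z \<in> {0..1}"
  shows "f z \<le> 1 + M"
proof -
  interpret prob_space leb01 by (rule prob_space_leb01)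
  have "(LINT x|leb01. f z) \<le> (LINT x|leb01. f x + M)"
  proof (rule integral_mono)
    show "integrable leb01 (\<lambda>x. f x + M)" using var_le_integrable[OF f(1)] by simp
    fix x assume "x \<in> space leb01"
    then show "f z \<le> f x + M" using var_le_oscillation[OF f(1), of x z] z by (auto simp: space_restrict_space)
  qed simp
  then show ?thesis using var_le_integrable[OF f(1)] f(2) by (simp add: prob_space[simplified])
qed

text \<open>The limit principle: \<open>f k\<close> are densities of uniformly bounded variation, \<open>S k\<close> converges to \<open>T\<close> pointwise, and
the distribution functions of \<open>f k\<close> before and after the action of \<open>S k\<close> become equal in the limit.\<close>
lemma asymptotically_invariant_limit:
  fixes f :: "nat \<Rightarrow> real \<Rightarrow> real"
  assumes T: "unique_acip_density T \<rho>" "\<And>t. AE x in leb01. T x \<noteq> t"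
    and S: "\<And>k. S k \<in> borel_measurable leb01" "\<And>x. x \<in> {0..1} \<Longrightarrow> (\<lambda>k. S k x) \<longlonglongrightarrow> T x"
    and f: "\<And>k. var_le (f k) 0 1 M" "\<And>k x. x \<in> {0..1} \<Longrightarrow> 0 \<le> f k x" "\<And>k. (LINT x|leb01. f k x) = 1"
    and inv: "\<And>t. (\<lambda>k. (LINT x|leb01. indicator {..t} (S k x) * f k x) -
        (LINT x|leb01. indicator {..t} x * f k x)) \<longlonglongrightarrow> 0"
  shows "\<exists>r. strict_mono (r::nat \<Rightarrow> nat) \<and> (\<lambda>k. LINT x|leb01. \<bar>\<rho> x - f (r k) x\<bar>) \<longlonglongrightarrow> 0"
proof -
  interpret L: prob_space leb01 by (rule prob_space_leb01)
  have f_bd: "\<bar>f k x\<bar> \<le> 1 + M" if "x \<in> {0..1}" for k x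
    using var_le_density_bound[OF f(1,3) that] f(2)[OF that, of k] by auto
  obtain r g0 where r: "strict_mono r" and g0: "AE x in leb01. (\<lambda>n. f (r n) x) \<longlonglongrightarrow> g0 x"
    using Helly_bounded_variation[of f M "1+M"] f(1) f_bd by auto
  define g where "g = (\<lambda>x. lim (\<lambda>n. f (r n) x))"
  have fm: "f k \<in> borel_measurable leb01" for k by (rule var_le_measurable[OF f(1)])
  have gm [measurable]: "g \<in> borel_measurable leb01"
    unfolding g_def by (rule borel_measurable_lim_metric) (rule fm)
  have lim: "AE x in leb01. (\<lambda>n. f (r n) x) \<longlonglongrightarrow> g x"
    using g0 by eventually_elim (auto simp: g_def limI)
  have in01: "AE x in leb01. x \<in> {0..1}" by (rule AE_I2) (auto simp: space_restrict_space)
  have g_bd: "AE x in leb01. 0 \<le> g x \<and> g x \<le> 1 + M"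
    using lim in01
  proof eventually_elim
    case (elim x)
    have "0 \<le> g x" by (rule LIMSEQ_le_const[OF elim(1)]) (use f(2)[OF elim(2)] in auto)
    moreover have "g x \<le> 1 + M"
      by (rule LIMSEQ_le_const2[OF elim(1)]) (use f_bd[OF elim(2)] in \<open>auto simp: abs_le_iff\<close>)
    ultimately show ?case by simp
  qed
  have gi: "integrable leb01 g"
    by (rule L.integrable_const_bound[of _ "1 + M"]) (use g_bd in auto)
  have f_bdAE: "AE x in leb01. \<bar>f k x\<bar> \<le> 1 + M" for k
    using in01 by eventually_elim (rule f_bd)
  have conv: "(\<lambda>n. LINT x|leb01. \<phi> n x * f (r n) x) \<longlonglongrightarrow> (LINT x|leb01. \<psi> x * g x)"
    if \<phi>: "\<And>n. \<phi> n \<in> borel_measurable leb01" "\<psi> \<in> borel_measurable leb01" "\<And>n x. \<bar>\<phi> n x\<bar> \<le> 1"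
      and l: "AE x in leb01. (\<lambda>n. \<phi> n x) \<longlonglongrightarrow> \<psi> x" for \<phi> :: "nat \<Rightarrow> real \<Rightarrow> real" and \<psi>
  proof (rule integral_dominated_convergence[where w = "\<lambda>x. 1 + M"])
    show "(\<lambda>x. \<psi> x * g x) \<in> borel_measurable leb01" using \<phi>(2) by measurable
    show "(\<lambda>x. \<phi> n x * f (r n) x) \<in> borel_measurable leb01" for n
      by (rule borel_measurable_times[OF \<phi>(1) fm])
    show "AE x in leb01. (\<lambda>n. \<phi> n x * f (r n) x) \<longlonglongrightarrow> \<psi> x * g x"
      using lim l by eventually_elim (rule tendsto_mult)
    show "AE x in leb01. norm (\<phi> n x * f (r n) x) \<le> 1 + M" for n
      using f_bdAE[of "r n"]
    proof eventually_elim
      case (elim x)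
      show ?case using mult_mono[OF \<phi>(3) elim, of n x] by (simp add: abs_mult)
    qed
  qed simp
  have g1: "(LINT x|leb01. g x) = 1"
  proof -
    have "(\<lambda>n. LINT x|leb01. 1 * f (r n) x) \<longlonglongrightarrow> (LINT x|leb01. 1 * g x)" by (rule conv) auto
    then show ?thesis using f(3) by (simp add: LIMSEQ_const_iff)
  qed
  have Tm: "T \<in> leb01 \<rightarrow>\<^sub>M leb01" using T(1) by (auto simp: unique_acip_density_def acip_def)
  have Tb [measurable]: "T \<in> borel_measurable leb01"
    using Tm by (auto dest: measurable_restrict_space2_iff[THEN iffD1] simp: measurable_lborel1)
  have ind_m [measurable]: "(\<lambda>x. indicator {..t} (h x) :: real) \<in> borel_measurable leb01"
    if "h \<in> borel_measurable leb01" for t :: real and h :: "real \<Rightarrow> real"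
    using that by measurable
  have id_m: "(\<lambda>x. x) \<in> borel_measurable leb01"
    by (simp add: measurable_restrict_space1)
  have inv_g: "(LINT x|leb01. indicator {..t} (T x) * g x) = (LINT x|leb01. indicator {..t} x * g x)" for t
  proof -
    \<comment> \<open>the indicator is continuous at \<open>T x\<close> unless \<open>T x = t\<close>, which has measure 0\<close>
    have 1: "(\<lambda>n. LINT x|leb01. indicator {..t} (S (r n) x) * f (r n) x) \<longlonglongrightarrow>
      (LINT x|leb01. indicator {..t} (T x) * g x)"
    proof (rule conv)
      show "AE x in leb01. (\<lambda>n. indicator {..t} (S (r n) x) :: real) \<longlonglongrightarrow> indicator {..t} (T x)"
        using T(2)[of t] in01
      proof eventually_elim
        case (elim x)
        have Sx: "(\<lambda>n. S (r n) x) \<longlonglongrightarrow> T x"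
          using LIMSEQ_subseq_LIMSEQ[OF S(2)[OF elim(2)] r] by (simp add: o_def)
        have "eventually (\<lambda>n. (indicator {..t} (S (r n) x) :: real) = indicator {..t} (T x)) sequentially"
        proof (cases "T x < t")
          case True
          show ?thesis using order_tendstoD(2)[OF Sx True] True
            by (auto elim!: eventually_mono simp: indicator_def)
        next
          case False
          then have "t < T x" using elim(1) by auto
          then show ?thesis using order_tendstoD(1)[OF Sx, of t]
            by (auto elim!: eventually_mono simp: indicator_def)
        qed
        then show ?case by (rule tendsto_eventually)
      qed
    qed (use S(1) in \<open>auto intro!: ind_m simp: indicator_def\<close>)
    have 2: "(\<lambda>n. LINT x|leb01. indicator {..t} x * f (r n) x) \<longlonglongrightarrow>
      (LINT x|leb01. indicator {..t} x * g x)"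
      by (rule conv) (use id_m in \<open>auto intro!: ind_m simp: indicator_def\<close>)
    have "(\<lambda>n. (LINT x|leb01. indicator {..t} (S (r n) x) * f (r n) x) -
        (LINT x|leb01. indicator {..t} x * f (r n) x)) \<longlonglongrightarrow> 0"
      using LIMSEQ_subseq_LIMSEQ[OF inv[of t] r] by (simp add: o_def)
    from LIMSEQ_unique[OF tendsto_diff[OF 1 2] this] show ?thesis by simp
  qed
  define \<nu> where "\<nu> = density leb01 (\<lambda>x. ennreal (g x))"
  have \<nu>_sets: "sets \<nu> = sets leb01" and \<nu>_space: "space \<nu> = {0..1}"
    by (auto simp: \<nu>_def space_restrict_space)
  have \<nu>_prob: "prob_space \<nu>"
  proof (rule prob_spaceI)
    have "emeasure \<nu> (space \<nu>) = (\<integral>\<^sup>+x. ennreal (g x) \<partial>leb01)"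
      unfolding \<nu>_def space_density by (rule emeasure_density_leb01[OF gm])
    also have "\<dots> = ennreal (LINT x|leb01. g x)"
      by (rule nn_integral_eq_integral[OF gi]) (use g_bd in auto)
    finally show "emeasure \<nu> (space \<nu>) = 1" using g1 by simp
  qed
  interpret N: prob_space \<nu> by (rule \<nu>_prob)
  have meas: "measure \<nu> {x \<in> space \<nu>. h x \<le> t} = (LINT x|leb01. indicator {..t} (h x) * g x)"
    if h: "h \<in> borel_measurable leb01" for h :: "real \<Rightarrow> real" and t
  proof -
    have A: "{x \<in> space \<nu>. h x \<le> t} \<in> sets \<nu>"
      unfolding \<nu>_def space_density sets_density using h by measurable
    have "measure \<nu> {x \<in> space \<nu>. h x \<le> t} = (LINT x|\<nu>. indicator {x \<in> space \<nu>. h x \<le> t} x)"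
      using A by simp
    also have "\<dots> = (LINT x|\<nu>. indicator {..t} (h x))"
      by (rule Bochner_Integration.integral_cong) (auto simp: indicator_def)
    also have "\<dots> = (LINT x|leb01. g x *\<^sub>R indicator {..t} (h x))"
      unfolding \<nu>_def by (rule integral_density) (use h ind_m g_bd in auto)
    finally show ?thesis by (simp add: mult.commute)
  qed
  \<comment> \<open>a measure on the line is determined by its distribution function\<close>
  have distr_eq: "distr \<nu> borel T = distr \<nu> borel (\<lambda>x. x)"
  proof (rule cdf_unique)
    have mT: "T \<in> borel_measurable \<nu>" and mi: "(\<lambda>x. x) \<in> borel_measurable \<nu>"
      using Tb id_m by (simp_all add: \<nu>_def)
    show "real_distribution (distr \<nu> borel T)" "real_distribution (distr \<nu> borel (\<lambda>x. x))"
      using mT mi by (auto intro!: N.real_distribution_distr)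
    show "cdf (distr \<nu> borel T) = cdf (distr \<nu> borel (\<lambda>x. x))"
    proof
      fix t
      have "cdf (distr \<nu> borel h) t = measure \<nu> {x \<in> space \<nu>. h x \<le> t}" if "h \<in> borel_measurable \<nu>" for h
        unfolding cdf_def using that by (subst measure_distr) (auto intro!: arg_cong[where f = "measure \<nu>"])
      then show "cdf (distr \<nu> borel T) t = cdf (distr \<nu> borel (\<lambda>x. x)) t"
        using mT mi meas[OF Tb] meas[OF id_m] inv_g by simp
    qed
  qed
  have "distr \<nu> leb01 T = \<nu>"
  proof (rule measure_eqI)
    show "sets (distr \<nu> leb01 T) = sets \<nu>" using \<nu>_sets by simp
    fix A assume "A \<in> sets (distr \<nu> leb01 T)"
    then have A: "A \<in> sets leb01" by simp
    then have Ab: "A \<in> sets borel" and sub: "A \<subseteq> {0..1}"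
      by (auto simp: sets_restrict_space)
    have mT: "T \<in> \<nu> \<rightarrow>\<^sub>M leb01" "T \<in> borel_measurable \<nu>" and mi: "(\<lambda>x. x) \<in> borel_measurable \<nu>"
      using Tm Tb id_m by (simp_all add: \<nu>_def)
    have "emeasure (distr \<nu> leb01 T) A = emeasure \<nu> (T -` A \<inter> space \<nu>)"
      by (rule emeasure_distr[OF mT(1) A])
    also have "\<dots> = emeasure (distr \<nu> borel T) A"
      by (rule emeasure_distr[OF mT(2) Ab, symmetric])
    also have "\<dots> = emeasure (distr \<nu> borel (\<lambda>x. x)) A" by (simp add: distr_eq)
    also have "\<dots> = emeasure \<nu> ((\<lambda>x. x) -` A \<inter> space \<nu>)"
      by (rule emeasure_distr[OF mi Ab])
    also have "(\<lambda>x. x) -` A \<inter> space \<nu> = A" using sub \<nu>_space by auto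
    finally show "emeasure (distr \<nu> leb01 T) A = emeasure \<nu> A" .
  qed
  moreover have "absolutely_continuous leb01 \<nu>"
    unfolding \<nu>_def by (rule absolutely_continuousI_density) measurable
  ultimately have "acip T \<nu>" using Tm \<nu>_sets \<nu>_prob by (auto simp: acip_def)
  then have "density leb01 (\<lambda>x. ennreal (g x)) = density leb01 (\<lambda>x. ennreal (\<rho> x))"
    and \<rho>m: "\<rho> \<in> borel_measurable leb01" and \<rho>0: "AE x in leb01. 0 \<le> \<rho> x"
    using T(1) by (auto simp: unique_acip_density_def \<nu>_def)
  then have "AE x in leb01. ennreal (g x) = ennreal (\<rho> x)"
    by (subst (asm) L.density_unique_iff) auto
  then have eq: "AE x in leb01. g x = \<rho> x"
    using g_bd \<rho>0 by eventually_elim auto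
  have "(\<lambda>k. LINT x|leb01. \<bar>\<rho> x - f (r k) x\<bar>) \<longlonglongrightarrow> (LINT x|leb01. 0)"
  proof (rule integral_dominated_convergence[where w = "\<lambda>x. 2 * (1 + M)"])
    show "(\<lambda>x. \<bar>\<rho> x - f (r k) x\<bar>) \<in> borel_measurable leb01" for k
      by (intro borel_measurable_abs borel_measurable_diff \<rho>m fm)
    show "AE x in leb01. (\<lambda>k. \<bar>\<rho> x - f (r k) x\<bar>) \<longlonglongrightarrow> 0"
      using lim eq
    proof eventually_elim
      case (elim x)
      show ?case using tendsto_rabs[OF tendsto_diff[OF tendsto_const[of "\<rho> x"] elim(1)]] elim(2) by simp
    qed
    show "AE x in leb01. norm \<bar>\<rho> x - f (r k) x\<bar> \<le> 2 * (1 + M)" for k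
      using g_bd eq f_bdAE[of "r k"] by eventually_elim auto
  qed auto
  with r show ?thesis by auto
qed

context cusp_system begin

lemma AE_S_neq: "AE x in leb01. S x \<noteq> t"
proof -
  have "AE x in lborel. x \<notin> {h1 t, h2 t}"
    by (rule AE_not_in[OF countable_imp_null_set_lborel]) auto
  then have "AE x in lborel. x \<in> {0..1} \<longrightarrow> S x \<noteq> t"
  proof eventually_elim
    case (elim x)
    show ?case
    proof (intro impI notI)
      assume "x \<in> {0..1}" "S x = t"
      then have "x = h1 t \<or> x = h2 t" using h1_S[of x] h2_S[of x] by (cases "x \<le> c") auto
      then show False using elim by blast
    qed
  qed
  then show ?thesis by (subst AE_restrict_space_iff) auto
qed

text \<open>If the iterates of the constant density have uniformly bounded variation, then their averages, which are
asymptotically invariant, approach the unique invariant density along a subsequence.\<close>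
lemma density_approximation:
  assumes \<rho>: "unique_acip_density S \<rho>" and M: "\<And>n. var_le ((transfer ^^ n) (\<lambda>x. 1)) 0 1 M"
    and e: "0 < e"
  shows "\<exists>f. var_le f 0 1 M \<and> (\<forall>x\<in>{0..1}. 0 \<le> f x) \<and> (LINT x|leb01. f x) = 1 \<and>
    (LINT x|leb01. \<bar>\<rho> x - f x\<bar>) \<le> e \<and>
    (\<forall>t. \<bar>(LINT x|leb01. indicator {..t} (S x) * f x) - (LINT x|leb01. indicator {..t} x * f x)\<bar> \<le> e)"
proof -
  interpret L: prob_space leb01 by (rule prob_space_leb01)
  define p where "p = (\<lambda>k. (transfer ^^ k) (\<lambda>x. 1))"
  define f where "f = (\<lambda>n x. (1 / real (Suc n)) * (\<Sum>k<Suc n. p k x))"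
  have one: "var_le (\<lambda>x. 1) 0 1 0" by (rule var_le_const) simp
  have p_var: "var_le (p k) 0 1 M" for k unfolding p_def by (rule M)
  have p_nn: "0 \<le> p k x" if "x \<in> {0..1}" for k x
    using transfer_iterates[OF one, of k] that by (simp add: p_def)
  have p_int: "(LINT x|leb01. p k x) = 1" for k
    using transfer_iterates[OF one, of k] by (simp add: p_def L.prob_space[simplified])
  have f_var: "var_le (f n) 0 1 M" for n
  proof -
    have "var_le (\<lambda>x. (1 / real (Suc n)) * (\<Sum>k<Suc n. p k x)) 0 1 (\<bar>1 / real (Suc n)\<bar> * (\<Sum>k<Suc n. M))"
      by (intro var_le_scale var_le_sum p_var) auto
    then show ?thesis by (simp add: f_def field_simps del: sum.lessThan_Suc of_nat_Suc)
  qed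
  have f_nn: "0 \<le> f n x" if "x \<in> {0..1}" for n x
    unfolding f_def using p_nn[OF that] by (intro mult_nonneg_nonneg sum_nonneg) auto
  have f_int: "(LINT x|leb01. \<phi> x * f n x) = (1 / real (Suc n)) * (\<Sum>k<Suc n. LINT x|leb01. \<phi> x * p k x)"
    if "\<phi> \<in> borel_measurable leb01" "\<And>x. \<bar>\<phi> x\<bar> \<le> 1" for \<phi> n
  proof -
    have i: "integrable leb01 (\<lambda>x. \<phi> x * p k x)" for k
      by (rule integrable_leb01_bounded_mult[OF that(1) _ var_le_integrable[OF p_var]]) (rule that(2))
    have "(LINT x|leb01. \<phi> x * f n x) = (LINT x|leb01. (1 / real (Suc n)) * (\<Sum>k<Suc n. \<phi> x * p k x))"
      by (rule Bochner_Integration.integral_cong) (simp_all add: f_def sum_distrib_left mult.left_commute del: sum.lessThan_Suc)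
    also have "\<dots> = (1 / real (Suc n)) * (\<Sum>k<Suc n. LINT x|leb01. \<phi> x * p k x)"
      using i by (simp only: integral_mult_right_zero Bochner_Integration.integral_sum)
    finally show ?thesis .
  qed
  have id_m: "(\<lambda>x. x) \<in> borel_measurable leb01"
    by (simp add: measurable_restrict_space1)
  have f_1: "(LINT x|leb01. f n x) = 1" for n
    using f_int[of "\<lambda>x. 1" n] p_int by (simp del: of_nat_Suc)
  have f_inv: "\<bar>(LINT x|leb01. indicator {..t} (S x) * f n x) - (LINT x|leb01. indicator {..t} x * f n x)\<bar>
      \<le> 1 / real (Suc n)" for n t
  proof -
    define a where "a = (\<lambda>k. LINT x|leb01. indicator {..t} x * p k x)"
    have ind: "(indicator {..t} :: real \<Rightarrow> real) \<in> borel_measurable borel" by measurable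
    have ind': "(indicator {..t} :: real \<Rightarrow> real) \<in> borel_measurable leb01"
      using measurable_compose[OF id_m ind] by simp
    have dual: "(LINT x|leb01. indicator {..t} (S x) * p k x) = a (Suc k)" for k
      using transfer_duality[OF p_var ind, of 1 k] by (simp add: a_def p_def indicator_def)
    have a: "0 \<le> a k \<and> a k \<le> 1" for k
    proof
      have i: "integrable leb01 (\<lambda>x. indicator {..t} x * p k x)"
        by (rule integrable_leb01_bounded_mult[OF ind' _ var_le_integrable[OF p_var], of 1])
          (simp add: indicator_def)
      show "0 \<le> a k" unfolding a_def
        by (rule integral_nonneg_AE, rule AE_I2) (use p_nn in \<open>auto simp: space_restrict_space\<close>)
      have "a k \<le> (LINT x|leb01. p k x)" unfolding a_def
        by (rule integral_mono[OF i var_le_integrable[OF p_var]])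
          (use p_nn in \<open>auto simp: space_restrict_space indicator_def\<close>)
      then show "a k \<le> 1" using p_int by simp
    qed
    have "(LINT x|leb01. indicator {..t} (S x) * f n x) = (1 / real (Suc n)) * (\<Sum>k<Suc n. a (Suc k))"
      using f_int[OF measurable_compose[OF S_measurable ind], of n] dual
      by (simp add: indicator_def del: of_nat_Suc sum.lessThan_Suc)
    moreover have "(LINT x|leb01. indicator {..t} x * f n x) = (1 / real (Suc n)) * (\<Sum>k<Suc n. a k)"
      using f_int[OF ind', of n] by (simp add: indicator_def a_def del: of_nat_Suc sum.lessThan_Suc)
    ultimately have "(LINT x|leb01. indicator {..t} (S x) * f n x) - (LINT x|leb01. indicator {..t} x * f n x)
        = (1 / real (Suc n)) * (\<Sum>k<Suc n. a (Suc k) - a k)"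
      by (simp only: sum_subtractf right_diff_distrib)
    also have "\<dots> = (1 / real (Suc n)) * (a (Suc n) - a 0)" by (simp only: sum_lessThan_telescope)
    finally have "\<bar>(LINT x|leb01. indicator {..t} (S x) * f n x) - (LINT x|leb01. indicator {..t} x * f n x)\<bar>
      = (1 / real (Suc n)) * \<bar>a (Suc n) - a 0\<bar>" by (simp add: abs_mult del: of_nat_Suc)
    also have "\<dots> \<le> (1 / real (Suc n)) * 1"
      by (rule mult_left_mono) (use a[of "Suc n"] a[of 0] in auto)
    finally show ?thesis by simp
  qed
  have "\<exists>r. strict_mono (r::nat \<Rightarrow> nat) \<and> (\<lambda>k. LINT x|leb01. \<bar>\<rho> x - f (r k) x\<bar>) \<longlonglongrightarrow> 0"
  proof (rule asymptotically_invariant_limit[OF \<rho> AE_S_neq, of "\<lambda>k. S", OF S_measurable _ f_var f_nn f_1])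
    fix t
    show "(\<lambda>k. (LINT x|leb01. indicator {..t} (S x) * f k x) -
        (LINT x|leb01. indicator {..t} x * f k x)) \<longlonglongrightarrow> 0"
      by (rule Lim_null_comparison[OF _ LIMSEQ_Suc[OF lim_const_over_n[of 1]]]) (use f_inv in auto)
  qed auto
  then obtain r where r: "strict_mono (r::nat \<Rightarrow> nat)"
    and lim: "(\<lambda>k. LINT x|leb01. \<bar>\<rho> x - f (r k) x\<bar>) \<longlonglongrightarrow> 0" by blast
  have "eventually (\<lambda>k. (LINT x|leb01. \<bar>\<rho> x - f (r k) x\<bar>) < e) sequentially"
    using order_tendstoD(2)[OF lim e] .
  moreover have "eventually (\<lambda>k. 1 / real (Suc k) < e) sequentially"
    using order_tendstoD(2)[OF LIMSEQ_Suc[OF lim_const_over_n[of 1]] e] by simp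
  ultimately have "eventually (\<lambda>k. (LINT x|leb01. \<bar>\<rho> x - f (r k) x\<bar>) < e \<and> 1 / real (Suc k) < e) sequentially"
    by eventually_elim auto
  then obtain k where k: "(LINT x|leb01. \<bar>\<rho> x - f (r k) x\<bar>) < e" "1 / real (Suc k) < e"
    by (auto simp: eventually_sequentially)
  have "1 / real (Suc (r k)) \<le> 1 / real (Suc k)"
    using seq_suble[OF r, of k] by (intro divide_left_mono) auto
  then have "\<bar>(LINT x|leb01. indicator {..t} (S x) * f (r k) x) - (LINT x|leb01. indicator {..t} x * f (r k) x)\<bar> \<le> e" for t
    using f_inv[of t "r k"] k(2) by linarith
  then show ?thesis using f_var f_nn f_1 k(1) by (intro exI[of _ "f (r k)"]) auto
qed

end

text \<open>The invariant densities of the maps \<open>S k\<close> are replaced by nearby densities of variation at most \<open>M\<close>, to which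
the limit principle applies.\<close>
lemma stability_from_uniform_variation:
  assumes T: "cusp_system T x0 v" "unique_acip_density T \<rho>"
    and S: "\<And>k. cusp_system (S k) (c k) (w k)" "\<And>k. unique_acip_density (S k) (\<sigma> k)"
    and conv: "\<And>x. x \<in> {0..1} \<Longrightarrow> (\<lambda>k. S k x) \<longlonglongrightarrow> T x"
    and var: "\<And>k n. var_le ((cusp_system.transfer (S k) (c k) (w k) ^^ n) (\<lambda>x. 1)) 0 1 M"
  shows "\<exists>r. strict_mono (r::nat \<Rightarrow> nat) \<and> (\<lambda>k. LINT x|leb01. \<bar>\<rho> x - \<sigma> (r k) x\<bar>) \<longlonglongrightarrow> 0"
proof -
  define approx where "approx = (\<lambda>k f. var_le f 0 1 M \<and> (\<forall>x\<in>{0..1}. 0 \<le> f x) \<and>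
    (LINT x|leb01. f x) = 1 \<and> (LINT x|leb01. \<bar>\<sigma> k x - f x\<bar>) \<le> 1 / real (Suc k) \<and>
    (\<forall>t. \<bar>(LINT x|leb01. indicator {..t} (S k x) * f x) - (LINT x|leb01. indicator {..t} x * f x)\<bar>
      \<le> 1 / real (Suc k)))"
  have "\<forall>k. \<exists>f. approx k f"
    unfolding approx_def by (intro allI cusp_system.density_approximation[OF S(1) S(2) var]) simp
  then obtain f where "\<forall>k. approx k (f k)" by (rule choice[THEN exE])
  then have f: "var_le (f k) 0 1 M" "x \<in> {0..1} \<Longrightarrow> 0 \<le> f k x"
    "(LINT x|leb01. f k x) = 1" "(LINT x|leb01. \<bar>\<sigma> k x - f k x\<bar>) \<le> 1 / real (Suc k)"
    "\<bar>(LINT x|leb01. indicator {..t} (S k x) * f k x) - (LINT x|leb01. indicator {..t} x * f k x)\<bar>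
      \<le> 1 / real (Suc k)" for k t x
    unfolding approx_def by blast+
  have inv: "(\<lambda>k. (LINT x|leb01. indicator {..t} (S k x) * f k x) -
        (LINT x|leb01. indicator {..t} x * f k x)) \<longlonglongrightarrow> 0" for t
    by (rule Lim_null_comparison[OF _ LIMSEQ_Suc[OF lim_const_over_n[of 1]]]) (use f(5) in auto)
  have "\<exists>r. strict_mono (r::nat \<Rightarrow> nat) \<and> (\<lambda>k. LINT x|leb01. \<bar>\<rho> x - f (r k) x\<bar>) \<longlonglongrightarrow> 0"
    by (rule asymptotically_invariant_limit[where S = S, OF T(2) cusp_system.AE_S_neq[OF T(1)]
        cusp_system.S_measurable[OF S(1)] conv f(1-3) inv])
  then obtain r where r: "strict_mono (r::nat \<Rightarrow> nat)"
    and lim: "(\<lambda>k. LINT x|leb01. \<bar>\<rho> x - f (r k) x\<bar>) \<longlonglongrightarrow> 0" by blast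
  have "(\<lambda>k. (LINT x|leb01. \<bar>\<rho> x - f (r k) x\<bar>) + 1 / real (Suc (r k))) \<longlonglongrightarrow> 0 + 0"
    using LIMSEQ_subseq_LIMSEQ[OF LIMSEQ_Suc[OF lim_const_over_n[of 1]] r]
    by (intro tendsto_add lim) (simp add: o_def)
  then have bound: "(\<lambda>k. (LINT x|leb01. \<bar>\<rho> x - f (r k) x\<bar>) + 1 / real (Suc (r k))) \<longlonglongrightarrow> 0" by simp
  have le: "(LINT x|leb01. \<bar>\<rho> x - \<sigma> j x\<bar>) \<le> (LINT x|leb01. \<bar>\<rho> x - f j x\<bar>) + 1 / real (Suc j)" for j
  proof -
    have i: "integrable leb01 \<rho>" "integrable leb01 (\<sigma> j)" "integrable leb01 (f j)"
      using density_integrable[OF T(2)] density_integrable[OF S(2)] var_le_integrable[OF f(1)] by auto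
    have "(LINT x|leb01. \<bar>\<rho> x - \<sigma> j x\<bar>) \<le> (LINT x|leb01. \<bar>\<rho> x - f j x\<bar> + \<bar>\<sigma> j x - f j x\<bar>)"
      by (rule integral_mono) (use i in auto)
    also have "\<dots> = (LINT x|leb01. \<bar>\<rho> x - f j x\<bar>) + (LINT x|leb01. \<bar>\<sigma> j x - f j x\<bar>)"
      by (rule Bochner_Integration.integral_add) (use i in auto)
    finally show ?thesis using f(4)[of j] by linarith
  qed
  have "(\<lambda>k. LINT x|leb01. \<bar>\<rho> x - \<sigma> (r k) x\<bar>) \<longlonglongrightarrow> 0"
  proof (rule Lim_null_comparison[OF always_eventually bound], rule allI)
    fix k
    show "norm (LINT x|leb01. \<bar>\<rho> x - \<sigma> (r k) x\<bar>)
        \<le> (LINT x|leb01. \<bar>\<rho> x - f (r k) x\<bar>) + 1 / real (Suc (r k))"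
      using le[of "r k"] by simp
  qed
  with r show ?thesis by blast
qed

section \<open>Uniform variation bounds along a convergent family of maps\<close>

lemma grid_cell:
  assumes "x \<in> {0..1::real}" "0 < (N::nat)"
  obtains j where "j < N" "real j / N \<le> x" "x \<le> real (Suc j) / N"
proof (cases "x = 1")
  case True
  then show ?thesis using that[of "N - 1"] assms(2) by (simp add: of_nat_diff)
next
  case False
  define j where "j = nat \<lfloor>x * N\<rfloor>"
  have "0 \<le> x * N" "x * N < N" using assms False by auto
  then have "real j \<le> x * N" "x * N \<le> real (Suc j)" "j < N"
    unfolding j_def by linarith+
  then show ?thesis using that[of j] assms(2) by (simp add: field_simps)
qed

text \<open>Polya's theorem: pointwise convergence of monotone functions to a continuous function is uniform.  One
interior point \<open>p\<close> may be exempted from the hypothesis; below it is the cusp of the limit map.\<close>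
lemma monotone_pointwise_imp_uniform_limit:
  fixes w :: "nat \<Rightarrow> real \<Rightarrow> real"
  assumes mono: "\<And>k. mono_on {0..1} (w k)" and cont: "continuous_on {0..1} v"
    and lim: "\<And>x. x \<in> {0..1} - {p} \<Longrightarrow> (\<lambda>k. w k x) \<longlonglongrightarrow> v x" and p: "0 < p" "p < 1"
  shows "uniform_limit {0..1} w v sequentially"
proof -
  have uc: "uniformly_continuous_on {0..1} v"
    by (rule compact_uniformly_continuous[OF cont]) simp
  have modulus: "\<exists>d>0. \<forall>x\<in>{0..1}. \<forall>y\<in>{0..1}. \<bar>x - y\<bar> < d \<longrightarrow> \<bar>v x - v y\<bar> < e" if "0 < e" for e
    using uc that unfolding uniformly_continuous_on_def dist_real_def by metis
  have lim_p: "(\<lambda>k. w k p) \<longlonglongrightarrow> v p"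
  proof (rule tendstoI)
    fix e :: real assume "0 < e"
    then obtain d where d: "0 < d" "\<forall>x\<in>{0..1}. \<forall>y\<in>{0..1}. \<bar>x - y\<bar> < d \<longrightarrow> \<bar>v x - v y\<bar> < e / 2"
      using modulus[of "e/2"] by auto
    define a where "a = max 0 (p - d / 2)"
    define b where "b = min 1 (p + d / 2)"
    have ab: "a \<in> {0..1} - {p}" "b \<in> {0..1} - {p}" "a < p" "p < b" "\<bar>a - p\<bar> < d" "\<bar>b - p\<bar> < d"
      using p d(1) by (auto simp: a_def b_def)
    then have close: "\<bar>v a - v p\<bar> < e / 2" "\<bar>v b - v p\<bar> < e / 2" using d(2) p by auto
    have "eventually (\<lambda>k. dist (w k a) (v a) < e / 2) sequentially"
      "eventually (\<lambda>k. dist (w k b) (v b) < e / 2) sequentially"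
      using tendstoD[OF lim[OF ab(1)], of "e/2"] tendstoD[OF lim[OF ab(2)], of "e/2"] \<open>0 < e\<close> by auto
    then show "eventually (\<lambda>k. dist (w k p) (v p) < e) sequentially"
    proof eventually_elim
      case (elim k)
      have "w k a \<le> w k p" "w k p \<le> w k b" using mono_onD[OF mono] ab p by auto
      then show ?case using elim close unfolding dist_real_def by linarith
    qed
  qed
  have lim': "(\<lambda>k. w k x) \<longlonglongrightarrow> v x" if "x \<in> {0..1}" for x
    using lim[of x] lim_p that by (cases "x = p") auto
  show ?thesis
  proof (rule uniform_limitI)
    fix e :: real assume e: "0 < e"
    then obtain d where d: "0 < d" "\<forall>x\<in>{0..1}. \<forall>y\<in>{0..1}. \<bar>x - y\<bar> < d \<longrightarrow> \<bar>v x - v y\<bar> < e / 2"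
      using modulus[of "e/2"] by auto
    obtain N :: nat where N: "0 < N" "1 / N < d"
      using real_arch_inverse[of d] d(1) by (auto simp: inverse_eq_divide)
    have "eventually (\<lambda>k. \<forall>j\<in>{..N}. dist (w k (real j / N)) (v (real j / N)) < e / 2) sequentially"
    proof (rule eventually_ball_finite, simp, rule ballI)
      fix j assume "j \<in> {..N}"
      then have "real j / N \<in> {0..1}" using N by auto
      from tendstoD[OF lim'[OF this], of "e/2"] e
      show "eventually (\<lambda>k. dist (w k (real j / N)) (v (real j / N)) < e / 2) sequentially" by simp
    qed
    then show "eventually (\<lambda>k. \<forall>x\<in>{0..1}. dist (w k x) (v x) < e) sequentially"
    proof eventually_elim
      case (elim k)
      show ?case
      proof
        fix x :: real assume x: "x \<in> {0..1}"
        obtain j where j: "j < N" "real j / N \<le> x" "x \<le> real (Suc j) / N"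
          using grid_cell[OF x N(1)] by metis
        have gap: "real (Suc j) / N - real j / N = 1 / N" using N by (simp add: field_simps)
        have in01: "real j / N \<in> {0..1}" "real (Suc j) / N \<in> {0..1}" using j N by auto
        have "\<bar>real j / N - x\<bar> < d" "\<bar>real (Suc j) / N - x\<bar> < d" using gap j N(2) by linarith+
        then have "\<bar>v (real j / N) - v x\<bar> < e / 2" "\<bar>v (real (Suc j) / N) - v x\<bar> < e / 2"
          using d(2) in01 x by blast+
        moreover have "dist (w k (real j / N)) (v (real j / N)) < e / 2"
          "dist (w k (real (Suc j) / N)) (v (real (Suc j) / N)) < e / 2"
          using bspec[OF elim, of j] bspec[OF elim, of "Suc j"] j by auto
        moreover have "w k (real j / N) \<le> w k x" "w k x \<le> w k (real (Suc j) / N)"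
          using mono_onD[OF mono] in01 x j by auto
        ultimately show "dist (w k x) (v x) < e" unfolding dist_real_def by linarith
      qed
    qed
  qed
qed

lemma uniform_limit_eventually_bounded:
  fixes f :: "nat \<Rightarrow> real \<Rightarrow> real"
  assumes "uniform_limit {0..1} f l sequentially" "continuous_on {0..1} l"
  shows "\<exists>B\<ge>1. eventually (\<lambda>k. \<forall>x\<in>{0..1}. \<bar>f k x\<bar> \<le> B) sequentially"
proof -
  have "bounded (l ` {0..1})"
    by (rule compact_imp_bounded[OF compact_continuous_image[OF assms(2)]]) simp
  then obtain B where B: "0 < B" "\<And>x. x \<in> {0..1} \<Longrightarrow> \<bar>l x\<bar> \<le> B"
    by (auto simp: bounded_pos)
  have "eventually (\<lambda>k. \<forall>x\<in>{0..1}. dist (f k x) (l x) < 1) sequentially"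
    by (rule uniform_limitD[OF assms(1)]) simp
  then have "eventually (\<lambda>k. \<forall>x\<in>{0..1}. \<bar>f k x\<bar> \<le> B + 1) sequentially"
  proof eventually_elim
    case (elim k)
    show ?case
    proof
      fix x :: real assume "x \<in> {0..1}"
      then have "dist (f k x) (l x) < 1" "\<bar>l x\<bar> \<le> B" using elim B(2) by auto
      then show "\<bar>f k x\<bar> \<le> B + 1" unfolding dist_real_def by linarith
    qed
  qed
  then show ?thesis using B(1) by (intro exI[of _ "B + 1"]) auto
qed

context cusp_system begin

text \<open>An interval is cut by the cusp into at most two pieces, on each of which \<open>S\<close> is monotone.\<close>
lemma var_le_compose_S:
  assumes u: "\<And>a' b'. 0 \<le> a' \<Longrightarrow> a' \<le> b' \<Longrightarrow> b' \<le> 1 \<Longrightarrow> b' - a' \<le> \<eta> \<Longrightarrow> var_le u a' b' \<delta>"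
    and S: "\<And>x y. x \<in> {a..b} \<Longrightarrow> y \<in> {a..b} \<Longrightarrow> \<bar>S x - S y\<bar> \<le> \<eta>"
    and ab: "0 \<le> a" "a \<le> b" "b \<le> 1"
  shows "var_le (\<lambda>z. u (S z)) a b (2 * \<delta>)"
proof -
  have left: "var_le (\<lambda>z. u (S z)) a' b' \<delta>" if "a \<le> a'" "a' \<le> b'" "b' \<le> b" "b' \<le> c" for a' b'
  proof (rule var_le_comp_mono[where f = u and h = S and c = "S a'" and d = "S b'"])
    show "mono_on {a'..b'} S"
      by (rule mono_onI) (use inc_le_iff that ab in auto)
    have "S a' \<le> S b'" using inc_le_iff[of a' b'] that ab by auto
    then show "var_le u (S a') (S b') \<delta>"
      using S[of a' b'] S_in[of a'] S_in[of b'] that ab by (intro u) auto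
  qed auto
  have right: "var_le (\<lambda>z. u (S z)) a' b' \<delta>" if "a \<le> a'" "a' \<le> b'" "b' \<le> b" "c \<le> a'" for a' b'
  proof (rule var_le_comp_antimono[where f = u and h = S and c = "S b'" and d = "S a'"])
    show "antimono_on {a'..b'} S"
      by (rule monotone_onI) (use dec_le_iff that ab in auto)
    have "S b' \<le> S a'" using dec_le_iff[of b' a'] that ab by auto
    then show "var_le u (S b') (S a') \<delta>"
      using S[of a' b'] S_in[of a'] S_in[of b'] that ab by (intro u) auto
  qed auto
  have "0 \<le> \<delta>" using left[of a a] right[of a a] ab var_le_oscillation[of _ a a \<delta> a a]
    by (cases "a \<le> c") fastforce+
  consider "b \<le> c" | "c \<le> a" | "a < c" "c < b" by linarith
  then show ?thesis
  proof cases
    case 1 then show ?thesis using left[of a b] ab \<open>0 \<le> \<delta>\<close> by (auto intro: var_le_weaken)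
  next
    case 2 then show ?thesis using right[of a b] ab \<open>0 \<le> \<delta>\<close> by (auto intro: var_le_weaken)
  next
    case 3
    then show ?thesis
      using var_le_append[of "\<lambda>z. u (S z)" a c \<delta> b \<delta>] left[of a c] right[of c b] ab by auto
  qed
qed

end

lemma uniform_equicontinuity:
  fixes f :: "nat \<Rightarrow> real \<Rightarrow> real"
  assumes "uniform_limit {0..1} f l sequentially" "continuous_on {0..1} l" "0 < e"
  shows "\<exists>d>0. eventually (\<lambda>k. \<forall>x\<in>{0..1}. \<forall>y\<in>{0..1}. \<bar>x - y\<bar> \<le> d \<longrightarrow> \<bar>f k x - f k y\<bar> \<le> e) sequentially"
proof -
  have "uniformly_continuous_on {0..1} l"
    by (rule compact_uniformly_continuous[OF assms(2)]) simp
  then obtain d where d: "0 < d" "\<And>x y. x \<in> {0..1} \<Longrightarrow> y \<in> {0..1} \<Longrightarrow> \<bar>x - y\<bar> < d \<Longrightarrow> \<bar>l x - l y\<bar> < e / 3"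
    using assms(3) unfolding uniformly_continuous_on_def dist_real_def
    by (metis zero_less_divide_iff zero_less_numeral)
  have "eventually (\<lambda>k. \<forall>x\<in>{0..1}. dist (f k x) (l x) < e / 3) sequentially"
    by (rule uniform_limitD[OF assms(1)]) (use assms(3) in simp)
  then have "eventually (\<lambda>k. \<forall>x\<in>{0..1}. \<forall>y\<in>{0..1}. \<bar>x - y\<bar> \<le> d / 2 \<longrightarrow> \<bar>f k x - f k y\<bar> \<le> e) sequentially"
  proof eventually_elim
    case (elim k)
    show ?case
    proof (intro ballI impI)
      fix x y :: real assume xy: "x \<in> {0..1}" "y \<in> {0..1}" "\<bar>x - y\<bar> \<le> d / 2"
      then have "\<bar>l x - l y\<bar> < e / 3" using d by auto
      moreover have "dist (f k x) (l x) < e / 3" "dist (f k y) (l y) < e / 3" using elim xy by auto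
      ultimately show "\<bar>f k x - f k y\<bar> \<le> e" unfolding dist_real_def by linarith
    qed
  qed
  then show ?thesis using d(1) by (intro exI[of _ "d / 2"]) auto
qed

text \<open>A sequence of cusp maps converging to \<open>T\<close>, for which the functions \<open>- 1 / S'\<close> converge as well.  Only the
limit function \<open>v\<close> has to be continuous.\<close>
locale cusp_family = T: cusp_system T x0 v
  for T x0 v +
  fixes S :: "nat \<Rightarrow> real \<Rightarrow> real" and c :: "nat \<Rightarrow> real" and w :: "nat \<Rightarrow> real \<Rightarrow> real"
  assumes v_cont: "continuous_on {0..1} v"
    and S: "\<And>k. cusp_system (S k) (c k) (w k)"
    and S_lim: "uniform_limit {0..1} S T sequentially"
    and w_lim: "uniform_limit {0..1} w v sequentially"
begin

text \<open>The reciprocal derivatives of the iterates of the maps of the family.\<close>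
abbreviation "q k n \<equiv> cusp_system.contraction (S k) (w k) n"

lemma T_contraction_cont: "continuous_on {0..1} (T.contraction n)"
proof (induction n)
  case (Suc n)
  have "continuous_on {0..1} (\<lambda>z. T.contraction n (T z))"
    by (rule continuous_on_compose2[OF Suc T.cont]) (use T.S_in in auto)
  then show ?case using v_cont by (auto intro!: continuous_intros)
qed simp

lemma contraction_lim: "uniform_limit {0..1} (\<lambda>k. q k n) (T.contraction n) sequentially"
proof (induction n)
  case 0
  show ?case by (rule uniform_limitI) (simp add: cusp_system.contraction.simps(1)[OF S])
next
  case (Suc n)
  have bd: "bounded (g ` {0..1})" if "continuous_on {0..1} g" for g :: "real \<Rightarrow> real"
    by (rule compact_imp_bounded[OF compact_continuous_image[OF that]]) simp
  have 1: "uniform_limit {0..1} (\<lambda>k z. \<bar>w k z\<bar>) (\<lambda>z. \<bar>v z\<bar>) sequentially"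
    using uniform_limit_norm[OF w_lim] by simp
  have "uniform_limit {0..1} (\<lambda>k z. T.contraction n (S k z)) (\<lambda>z. T.contraction n (T z)) sequentially"
    by (rule uniform_limit_compose_uniformly_continuous_on[OF S_lim
          compact_uniformly_continuous[OF T_contraction_cont]])
      (use cusp_system.S_in[OF S] in auto)
  moreover have "uniform_limit {0..1} (\<lambda>k z. q k n (S k z) - T.contraction n (S k z)) (\<lambda>z. 0) sequentially"
  proof (rule uniform_limitI)
    fix e :: real assume "0 < e"
    from uniform_limitD[OF Suc this]
    show "\<forall>\<^sub>F k in sequentially. \<forall>x\<in>{0..1}. dist (q k n (S k x) - T.contraction n (S k x)) 0 < e"
      by eventually_elim (use cusp_system.S_in[OF S] in \<open>auto simp: dist_real_def\<close>)
  qed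
  ultimately have "uniform_limit {0..1} (\<lambda>k z. T.contraction n (S k z) + (q k n (S k z) - T.contraction n (S k z)))
      (\<lambda>z. T.contraction n (T z) + 0) sequentially"
    by (rule uniform_limit_add)
  then have 2: "uniform_limit {0..1} (\<lambda>k z. q k n (S k z)) (\<lambda>z. T.contraction n (T z)) sequentially"
    by simp
  have "uniform_limit {0..1} (\<lambda>k z. \<bar>w k z\<bar> * q k n (S k z)) (\<lambda>z. \<bar>v z\<bar> * T.contraction n (T z)) sequentially"
    by (rule uniform_lim_mult[OF 1 2])
      (auto intro!: bd continuous_intros v_cont continuous_on_compose2[OF T_contraction_cont T.cont] simp: T.S_in[simplified])
  then show ?case by (simp add: cusp_system.contraction.simps(2)[OF S])
qed

text \<open>The variation of \<open>q k n\<close> over short intervals is small, uniformly in \<open>k\<close>.  In the induction step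
\<open>q k (Suc n)\<close> is the product of \<open>\<bar>w k\<bar>\<close> and \<open>q k n \<circ> S k\<close>; the variation of the monotone function \<open>w k\<close> over an
interval is its increment, which equicontinuity controls.\<close>
lemma contraction_cell_variation:
  assumes "0 < \<delta>"
  shows "\<exists>\<eta>>0. eventually (\<lambda>k. \<forall>a b. 0 \<le> a \<longrightarrow> a \<le> b \<longrightarrow> b \<le> 1 \<longrightarrow> b - a \<le> \<eta> \<longrightarrow> var_le (q k n) a b \<delta>) sequentially"
  using assms
proof (induction n arbitrary: \<delta>)
  case 0
  have "q k 0 = (\<lambda>z. 1)" for k by (rule ext) (simp add: cusp_system.contraction.simps(1)[OF S])
  then have "var_le (q k 0) a b \<delta>" for k a b using var_le_const[of \<delta> 1] 0 by simp
  then show ?case by (intro exI[of _ 1]) simp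
next
  case (Suc n)
  obtain B where B: "1 \<le> B" "eventually (\<lambda>k. \<forall>x\<in>{0..1}. \<bar>w k x\<bar> \<le> B) sequentially"
    using uniform_limit_eventually_bounded[OF w_lim v_cont] by blast
  obtain K where K: "1 \<le> K" "eventually (\<lambda>k. \<forall>x\<in>{0..1}. \<bar>q k n x\<bar> \<le> K) sequentially"
    using uniform_limit_eventually_bounded[OF contraction_lim T_contraction_cont] by blast
  obtain \<eta>1 where \<eta>1: "0 < \<eta>1" "eventually (\<lambda>k. \<forall>a b. 0 \<le> a \<longrightarrow> a \<le> b \<longrightarrow> b \<le> 1 \<longrightarrow> b - a \<le> \<eta>1
      \<longrightarrow> var_le (q k n) a b (\<delta> / (4 * B))) sequentially"
    using Suc.IH[of "\<delta> / (4 * B)"] Suc.prems B(1) by auto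
  obtain \<eta>2 where \<eta>2: "0 < \<eta>2"
    "eventually (\<lambda>k. \<forall>x\<in>{0..1}. \<forall>y\<in>{0..1}. \<bar>x - y\<bar> \<le> \<eta>2 \<longrightarrow> \<bar>S k x - S k y\<bar> \<le> \<eta>1) sequentially"
    using uniform_equicontinuity[OF S_lim T.cont \<eta>1(1)] by blast
  obtain \<eta>3 where \<eta>3: "0 < \<eta>3"
    "eventually (\<lambda>k. \<forall>x\<in>{0..1}. \<forall>y\<in>{0..1}. \<bar>x - y\<bar> \<le> \<eta>3 \<longrightarrow> \<bar>w k x - w k y\<bar> \<le> \<delta> / (2 * K)) sequentially"
    using uniform_equicontinuity[OF w_lim v_cont, of "\<delta> / (2 * K)"] Suc.prems K(1) by auto
  have "eventually (\<lambda>k. \<forall>a b. 0 \<le> a \<longrightarrow> a \<le> b \<longrightarrow> b \<le> 1 \<longrightarrow> b - a \<le> min \<eta>2 \<eta>3 \<longrightarrow> var_le (q k (Suc n)) a b \<delta>) sequentially"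
    using B(2) K(2) \<eta>1(2) \<eta>2(2) \<eta>3(2)
  proof eventually_elim
    case (elim k)
    show ?case
    proof (intro allI impI)
      fix a b :: real assume ab: "0 \<le> a" "a \<le> b" "b \<le> 1" "b - a \<le> min \<eta>2 \<eta>3"
      have "var_le (\<lambda>z. q k n (S k z)) a b (2 * (\<delta> / (4 * B)))"
      proof (rule cusp_system.var_le_compose_S[OF S])
        show "\<bar>S k x - S k y\<bar> \<le> \<eta>1" if "x \<in> {a..b}" "y \<in> {a..b}" for x y
          using elim(4) that ab by auto
      qed (use elim(3) ab in auto)
      moreover have "var_le (\<lambda>z. \<bar>w k z\<bar>) a b (\<delta> / (2 * K))"
      proof -
        have "mono_on {a..b} (w k)"
          by (rule mono_on_subset[OF cusp_system.v_mono[OF S]]) (use ab in auto)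
        then have "var_le (\<lambda>z. \<bar>w k z\<bar>) a b (w k b - w k a)" by (intro var_le_abs var_le_mono)
        moreover have "\<bar>w k b - w k a\<bar> \<le> \<delta> / (2 * K)"
          using elim(5) ab by auto
        ultimately show ?thesis by (auto intro: var_le_weaken)
      qed
      ultimately have "var_le (\<lambda>z. \<bar>w k z\<bar> * q k n (S k z)) a b (B * (2 * (\<delta> / (4 * B))) + K * (\<delta> / (2 * K)))"
        by (intro var_le_mult)
          (use elim(1,2) ab cusp_system.S_in[OF S] in auto)
      moreover have "B * (2 * (\<delta> / (4 * B))) + K * (\<delta> / (2 * K)) = \<delta>"
        using B(1) K(1) by (simp add: field_simps)
      moreover have "q k (Suc n) = (\<lambda>z. \<bar>w k z\<bar> * q k n (S k z))"
        by (rule ext) (rule cusp_system.contraction.simps(2)[OF S])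
      ultimately show "var_le (q k (Suc n)) a b \<delta>" by metis
    qed
  qed
  then show ?case using \<eta>2(1) \<eta>3(1) by (intro exI[of _ "min \<eta>2 \<eta>3"]) auto
qed

lemma grid_variation:
  assumes "0 < \<delta>"
  shows "\<exists>N>0. eventually (\<lambda>k. \<forall>j<N. var_le (q k n) (real j / real N) (real (Suc j) / real N) \<delta>) sequentially"
proof -
  obtain \<eta> where \<eta>: "0 < \<eta>" "eventually (\<lambda>k. \<forall>a b. 0 \<le> a \<longrightarrow> a \<le> b \<longrightarrow> b \<le> 1 \<longrightarrow> b - a \<le> \<eta> \<longrightarrow> var_le (q k n) a b \<delta>) sequentially"
    using contraction_cell_variation[OF assms] by blast
  obtain N :: nat where N: "0 < N" "1 / N < \<eta>"
    using real_arch_inverse[of \<eta>] \<eta>(1) by (auto simp: inverse_eq_divide)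
  from \<eta>(2) have "eventually (\<lambda>k. \<forall>j<N. var_le (q k n) (real j / real N) (real (Suc j) / real N) \<delta>) sequentially"
  proof eventually_elim
    case (elim k)
    show ?case
    proof (intro allI impI)
      fix j assume j: "j < N"
      have "real (Suc j) / N - real j / N = 1 / N" using N by (simp add: field_simps)
      then have "real (Suc j) / N - real j / N \<le> \<eta>" using N by linarith
      moreover have "real j / N \<le> real (Suc j) / N" by (simp add: divide_right_mono)
      moreover have "real (Suc j) / N \<le> 1" using j N(1) by simp
      ultimately show "var_le (q k n) (real j / real N) (real (Suc j) / real N) \<delta>" using elim by simp
    qed
  qed
  with N show ?thesis by blast
qed

text \<open>The transfer operators of the maps of the family.\<close>
abbreviation "P k \<equiv> cusp_system.transfer (S k) (c k) (w k)"

lemma iterate_variation_bounded: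
  "\<exists>K\<ge>0. eventually (\<lambda>k. var_le ((P k ^^ n) (\<lambda>x. 1)) 0 1 K) sequentially"
proof -
  interpret L: prob_space leb01 by (rule prob_space_leb01)
  obtain B where B: "1 \<le> B" "eventually (\<lambda>k. \<forall>x\<in>{0..1}. \<bar>q k n x\<bar> \<le> B) sequentially"
    using uniform_limit_eventually_bounded[OF contraction_lim T_contraction_cont] by blast
  obtain N where N: "0 < N" "eventually (\<lambda>k. \<forall>j<N. var_le (q k n) (real j / real N) (real (Suc j) / real N) 1) sequentially"
    using grid_variation[of 1 n] by auto
  have "eventually (\<lambda>k. var_le ((P k ^^ n) (\<lambda>x. 1)) 0 1 (real N)) sequentially"
    using B(2) N(2)
  proof eventually_elim
    case (elim k)
    have "var_le ((P k ^^ n) (\<lambda>x. 1)) 0 1 ((B + 1) * 0 + 1 * real N)"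
    proof (rule cusp_system.Lasota_Yorke[OF S N(1)])
      show "(LINT x|leb01. 1) = (1::real)" by (simp add: L.prob_space[simplified])
      show "q k n z \<le> B" if "z \<in> {0..1}" for z using elim(1) that by (auto simp: abs_le_iff)
    qed (use elim(2) var_le_const[of 0 1 0 1] in auto)
    then show ?case by simp
  qed
  then show ?thesis by (intro exI[of _ "real N"]) auto
qed

text \<open>Eventually \<open>q k n0 \<le> 1 / 2\<close>, so that with \<open>\<delta> = 1 / 4\<close> the inequality \<open>Lasota_Yorke\<close> maps variation at most \<open>M\<close>
to variation at most \<open>3 / 4 * M + N / 4\<close>, which is at most \<open>M\<close> if \<open>N \<le> M\<close>.
The constant \<open>M\<close> is chosen to bound the variation of the first \<open>n0\<close> iterates as well.\<close>
lemma uniform_variation_bound: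
  assumes expand: "\<And>z. z \<in> {0..1} \<Longrightarrow> T.contraction n0 z \<le> 1 / 4"
  shows "\<exists>M. eventually (\<lambda>k. \<forall>n. var_le ((P k ^^ n) (\<lambda>x. 1)) 0 1 M) sequentially"
proof -
  interpret L: prob_space leb01 by (rule prob_space_leb01)
  have n0: "0 < n0"
  proof (rule ccontr)
    assume "\<not> 0 < n0"
    then show False using expand[of 0] by simp
  qed
  obtain N where N: "0 < N" "eventually (\<lambda>k. \<forall>j<N. var_le (q k n0) (real j / real N) (real (Suc j) / real N) (1/4)) sequentially"
    using grid_variation[of "1/4" n0] by auto
  define good where "good = (\<lambda>m K. 0 \<le> K \<and> eventually (\<lambda>k. var_le ((P k ^^ m) (\<lambda>x. 1)) 0 1 K) sequentially)"
  have "\<forall>m. \<exists>K. good m K" unfolding good_def using iterate_variation_bounded by blast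
  then obtain K where "\<forall>m. good m (K m)" by (rule choice[THEN exE])
  then have K: "0 \<le> K m" "eventually (\<lambda>k. var_le ((P k ^^ m) (\<lambda>x. 1)) 0 1 (K m)) sequentially" for m
    unfolding good_def by blast+
  define M where "M = real N + (\<Sum>m<n0. K m)"
  have M: "real N \<le> M" and KM: "K m \<le> M" if "m < n0" for m
    using K(1) that by (auto simp: M_def sum_nonneg intro!: add_increasing member_le_sum)
  have "real N \<le> M" using M[OF n0] .
  have small: "eventually (\<lambda>k. \<forall>z\<in>{0..1}. dist (q k n0 z) (T.contraction n0 z) < 1/4) sequentially"
    by (rule uniform_limitD[OF contraction_lim]) simp
  have base: "eventually (\<lambda>k. \<forall>m\<in>{..<n0}. var_le ((P k ^^ m) (\<lambda>x. 1)) 0 1 (K m)) sequentially"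
    by (rule eventually_ball_finite) (use K(2) in auto)
  have "eventually (\<lambda>k. \<forall>n. var_le ((P k ^^ n) (\<lambda>x. 1)) 0 1 M) sequentially"
    using N(2) small base
  proof eventually_elim
    case (elim k)
    show ?case
    proof
      fix n
      show "var_le ((P k ^^ n) (\<lambda>x. 1)) 0 1 M"
      proof (induction n rule: less_induct)
        case (less n)
        show ?case
        proof (cases "n < n0")
          case True
          then show ?thesis using elim(3) KM by (auto intro: var_le_weaken)
        next
          case False
          define f where "f = (P k ^^ (n - n0)) (\<lambda>x. 1)"
          have "(P k ^^ n) (\<lambda>x. 1) = (P k ^^ n0) f"
            using False unfolding f_def by (metis comp_apply funpow_add le_add_diff_inverse not_less)
          moreover have "var_le ((P k ^^ n0) f) 0 1 ((1/2 + 1/4) * M + 1/4 * real N)"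
          proof (rule cusp_system.Lasota_Yorke[OF S N(1)])
            show "q k n0 z \<le> 1/2" if "z \<in> {0..1}" for z
              using bspec[OF elim(2) that] expand[OF that] unfolding dist_real_def by linarith
            show "var_le f 0 1 M" unfolding f_def using less[of "n - n0"] False n0 by simp
            have f: "(\<forall>x\<in>{0..1}. 0 \<le> f x) \<and> (LINT x|leb01. f x) = (LINT x|leb01. 1)"
              unfolding f_def
              using cusp_system.transfer_iterates[OF S[of k] var_le_const[of 0 1 0 1], where n = "n - n0"]
              by auto
            then show "(LINT x|leb01. f x) = 1" by (simp add: L.prob_space[simplified])
            show "0 \<le> f x" if "x \<in> {0..1}" for x using f that by blast
          qed (use elim(1) in auto)
          ultimately show ?thesis using \<open>real N \<le> M\<close> by (auto intro: var_le_weaken)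
        qed
      qed
    qed
  qed
  then show ?thesis by blast
qed

end

section \<open>Convexity and expansion\<close>

text \<open>A convex function lies above its tangents, also at an end point of its domain.\<close>
lemma tangent_le:
  assumes conv: "convex_on A S" and A: "A \<subseteq> {0..1}" "x \<in> A" "y \<in> A" and diff: "diff01 S x"
  shows "D S x * (y - x) \<le> S y - S x"
proof -
  define g where "g = (\<lambda>t::real. x + t * (y - x))"
  have xy: "x \<in> {0..1}" "y \<in> {0..1}" using A by auto
  have g01: "g ` {0..1} \<subseteq> {0..1}"
  proof
    fix z assume "z \<in> g ` {0..1}"
    then obtain t where t: "t \<in> {0..1}" "z = g t" by blast
    have "z = (1 - t) *\<^sub>R x + t *\<^sub>R y" using t by (simp add: g_def algebra_simps)
    also have "\<dots> \<in> {0..1}" by (rule convexD[of "{0..1::real}"]) (use xy t in auto)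
    finally show "z \<in> {0..1}" .
  qed
  have "(S has_vector_derivative D S x) (at x within {0..1})"
    using diff by (simp add: vector_derivative_works)
  then have "(S has_real_derivative D S x) (at (g 0) within {0..1})"
    by (simp add: has_real_derivative_iff_has_vector_derivative g_def)
  then have "(S has_real_derivative D S x) (at (g 0) within g ` {0..1})"
    by (rule DERIV_subset[OF _ g01])
  moreover have "(g has_real_derivative (y - x)) (at 0 within {0..1})"
    unfolding g_def by (auto intro!: derivative_eq_intros)
  ultimately have "(S \<circ> g has_real_derivative D S x * (y - x)) (at 0 within {0..1})"
    by (rule DERIV_image_chain)
  then have lim: "((\<lambda>t. (S (g t) - S x) / t) \<longlongrightarrow> D S x * (y - x)) (at 0 within {0..1})"
    by (simp add: has_field_derivative_iff g_def)
  show ?thesis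
  proof (rule tendsto_upperbound[OF lim])
    show "\<forall>\<^sub>F t in at 0 within {0..1}. (S (g t) - S x) / t \<le> S y - S x"
      unfolding eventually_at_filter
    proof (intro always_eventually allI impI)
      fix t :: real assume t: "t \<noteq> 0" "t \<in> {0..1}"
      have "S ((1 - t) *\<^sub>R x + t *\<^sub>R y) \<le> (1 - t) * S x + t * S y"
        by (rule convex_onD[OF conv]) (use t A in auto)
      then have "S (g t) - S x \<le> t * (S y - S x)" by (simp add: g_def algebra_simps)
      then show "(S (g t) - S x) / t \<le> S y - S x" using t by (simp add: pos_divide_le_eq mult.commute)
    qed
    have "at (0::real) within {0..1} = at_right 0" by (simp add: at_within_Icc_at_right)
    then show "at (0::real) within {0..1} \<noteq> bot" by simp
  qed
qed

lemma convex_slope_mono: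
  assumes "convex_on A S" "A \<subseteq> {0..1}" "x \<in> A" "y \<in> A" "x \<le> y" "diff01 S x" "diff01 S y"
  shows "D S x \<le> D S y"
proof (cases "x = y")
  case False
  have "D S x * (y - x) \<le> S y - S x" "D S y * (x - y) \<le> S x - S y"
    using tangent_le[OF assms(1,2)] assms by auto
  then have "D S x * (y - x) \<le> D S y * (y - x)" by (simp add: algebra_simps)
  then show ?thesis using False assms(5) by simp
qed simp

text \<open>The function \<open>v\<close> of a cusp map.  The value 0 at the cusp is the limit for a map with infinite slope there.\<close>
definition neg_inverse_slope :: "(real \<Rightarrow> real) \<Rightarrow> real \<Rightarrow> real \<Rightarrow> real" where
  "neg_inverse_slope S c z = (if z = c then 0 else - 1 / D S z)"

text \<open>Convexity makes the derivative nondecreasing on each branch, so its signs at the two end points of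
\<open>{0..1}\<close> determine its sign everywhere.  Surjectivity of the monotone branches gives continuity at the cusp.\<close>
lemma cusp_systemI:
  assumes c: "0 < c" "c < 1" and conv: "convex_on {0..c} S" "convex_on {c..1} S"
    and onto: "S ` {0..c} = {0..1}" "S ` {c..1} = {0..1}"
    and diff: "\<And>x. x \<in> {0..1} - {c} \<Longrightarrow> diff01 S x" and ends: "0 < D S 0" "D S 1 < 0"
  shows "cusp_system S c (neg_inverse_slope S c)"
proof -
  let ?v = "neg_inverse_slope S c"
  have sub: "{0..c} \<subseteq> {0..1}" "{c..1} \<subseteq> {0..1}" using c by auto
  have mono1: "D S x \<le> D S y" if "0 \<le> x" "x \<le> y" "y < c" for x y
    by (rule convex_slope_mono[OF conv(1) sub(1)]) (use that c diff in auto)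
  have mono2: "D S x \<le> D S y" if "c < x" "x \<le> y" "y \<le> 1" for x y
    by (rule convex_slope_mono[OF conv(2) sub(2)]) (use that c diff in auto)
  have pos: "0 < D S x" if "0 \<le> x" "x < c" for x using mono1[of 0 x] that ends by auto
  have neg: "D S x < 0" if "c < x" "x \<le> 1" for x using mono2[of x 1] that ends by auto
  have inc: "S x < S y" if "0 \<le> x" "x < y" "y \<le> c" for x y
  proof -
    have "D S x * (y - x) \<le> S y - S x"
      by (rule tangent_le[OF conv(1) sub(1)]) (use that c diff in auto)
    moreover have "0 < D S x * (y - x)" using pos[of x] that by simp
    ultimately show ?thesis by linarith
  qed
  have dec: "S y < S x" if "c \<le> x" "x < y" "y \<le> 1" for x y
  proof -
    have "D S y * (x - y) \<le> S x - S y"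
      by (rule tangent_le[OF conv(2) sub(2)]) (use that c diff in auto)
    moreover have "0 < D S y * (x - y)" using neg[of y] that by (simp add: mult_neg_neg)
    ultimately show ?thesis by linarith
  qed
  have in1: "S x \<in> {0..1}" if "x \<in> {0..c}" for x using onto(1) that by blast
  have in2: "S x \<in> {0..1}" if "x \<in> {c..1}" for x using onto(2) that by blast
  have "0 \<in> S ` {0..c}" "1 \<in> S ` {0..c}" "0 \<in> S ` {c..1}" using onto by auto
  then obtain z0 z1 z2 where z: "z0 \<in> {0..c}" "S z0 = 0" "z1 \<in> {0..c}" "S z1 = 1" "z2 \<in> {c..1}" "S z2 = 0"
    by force
  have S0: "S 0 = 0" using inc[of 0 z0] in1[of 0] z c by (cases "z0 = 0") auto
  have Sc: "S c = 1" using inc[of z1 c] in1[of c] z c by (cases "z1 = c") auto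
  have S1: "S 1 = 0" using dec[of z2 1] in2[of 1] z c by (cases "z2 = 1") auto
  have cont: "continuous_on {0..1} S"
    unfolding continuous_on_eq_continuous_within
  proof
    fix x :: real assume x: "x \<in> {0..1}"
    show "continuous (at x within {0..1}) S"
    proof (cases "x = c")
      case False
      then show ?thesis using diff[of x] x by (intro differentiable_imp_continuous_within) auto
    next
      case True
      have "(S \<longlongrightarrow> S c) (at c within {0..1})"
      proof (rule tendstoI)
        fix e :: real assume e: "0 < e"
        define y where "y = 1 - min e 1 / 2"
        have y: "y \<in> {0..1}" "y < 1" "1 - y < e" using e by (auto simp: y_def)
        then obtain l where l: "l \<in> {0..c}" "S l = y" using onto(1) by (metis imageE)
        obtain r where r: "r \<in> {c..1}" "S r = y" using onto(2) y by (metis imageE)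
        have "l \<noteq> c" "r \<noteq> c" using l r y Sc by auto
        then have lr: "l < c" "c < r" using l r by auto
        have "eventually (\<lambda>z. z \<in> {l<..<r}) (nhds c)"
          by (rule eventually_nhds_in_open) (use lr in auto)
        then show "eventually (\<lambda>z. dist (S z) (S c) < e) (at c within {0..1})"
          unfolding eventually_at_filter
        proof eventually_elim
          case (elim z)
          show ?case
          proof (intro impI)
            assume "z \<noteq> c" "z \<in> {0..1}"
            have "y \<le> S z \<and> S z \<le> 1"
            proof (cases "z < c")
              case True
              then show ?thesis using inc[of l z] in1[of z] elim l \<open>z \<in> {0..1}\<close> by auto
            next
              case False
              then show ?thesis using dec[of z r] in2[of z] elim r \<open>z \<in> {0..1}\<close> by auto
            qed
            then show "dist (S z) (S c) < e" using y Sc by (auto simp: dist_real_def)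
          qed
        qed
      qed
      then show ?thesis using True by (simp add: continuous_within)
    qed
  qed
  have vneg: "?v z < 0" if "0 \<le> z" "z < c" for z
    using pos[OF that] that by (simp add: neg_inverse_slope_def)
  have vpos: "0 < ?v z" if "c < z" "z \<le> 1" for z
    using neg[OF that] that by (simp add: neg_inverse_slope_def divide_neg_neg)
  have vc: "?v c = 0" by (simp add: neg_inverse_slope_def)
  have v_mono: "mono_on {0..1} ?v"
  proof (rule mono_onI)
    fix x y :: real assume xy: "x \<in> {0..1}" "y \<in> {0..1}" "x \<le> y"
    consider "y < c" | "x \<le> c" "c \<le> y" | "c < x" by linarith
    then show "?v x \<le> ?v y"
    proof cases
      case 1
      then show ?thesis using mono1[of x y] pos[of x] pos[of y] xy
        by (simp add: neg_inverse_slope_def frac_le)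
    next
      case 2
      then have "?v x \<le> 0" "0 \<le> ?v y"
        using vneg[of x] vpos[of y] vc xy by (cases "x = c"; cases "y = c"; force)+
      then show ?thesis by linarith
    next
      case 3
      then have "D S x \<le> D S y" "D S x < 0" "D S y < 0"
        using mono2[of x y] neg[of x] neg[of y] xy by auto
      then have "- inverse (D S x) \<le> - inverse (D S y)"
        using le_imp_inverse_le_neg[of "D S x" "D S y"] by simp
      then show ?thesis using 3 xy by (simp add: neg_inverse_slope_def inverse_eq_divide)
    qed
  qed
  have deriv: "(S has_real_derivative (- 1 / ?v z)) (at z)" if z: "0 < z" "z < 1" "z \<noteq> c" for z
  proof -
    have "(S has_vector_derivative D S z) (at z within {0..1})"
      using diff[of z] z by (simp add: vector_derivative_works)
    then have "(S has_real_derivative D S z) (at z)"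
      using z by (simp add: has_real_derivative_iff_has_vector_derivative at_within_Icc_at)
    moreover have "D S z \<noteq> 0" using pos[of z] neg[of z] z by (cases "z < c") auto
    ultimately show ?thesis using z by (simp add: neg_inverse_slope_def)
  qed
  show ?thesis
  proof
    show "strict_mono_on {0..c} S" by (rule strict_mono_onI) (use inc in auto)
    show "strict_antimono_on {c..1} S" by (rule monotone_onI) (use dec in auto)
  qed (use c cont S0 Sc S1 v_mono vneg vpos vc deriv in auto)
qed

context cusp_system begin

lemma contraction_le_power:
  assumes "y \<in> {0..1}" "\<And>i. i < n \<Longrightarrow> (S ^^ i) y \<le> c" "\<And>z. z \<in> {0..c} \<Longrightarrow> \<bar>v z\<bar> \<le> b"
  shows "contraction n y \<le> b ^ n"
  using assms(1,2)
proof (induction n arbitrary: y)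
  case (Suc n)
  have "contraction n (S y) \<le> b ^ n"
  proof (rule Suc.IH)
    fix i assume "i < n"
    then show "(S ^^ i) (S y) \<le> c" using Suc.prems(2)[of "Suc i"] by (simp add: funpow_swap1)
  qed (rule S_in[OF Suc.prems(1)])
  moreover have "\<bar>v y\<bar> \<le> b" using assms(3)[of y] Suc.prems(1) Suc.prems(2)[of 0] by auto
  ultimately show ?case by (auto intro!: mult_mono contraction_nonneg)
qed simp

lemma cusp_preimages: "(h1 ^^ n) c \<in> {0..c}" "0 < n \<Longrightarrow> (h1 ^^ n) c < c"
proof -
  show 1: "(h1 ^^ n) c \<in> {0..c}" for n
    by (induction n) (use c h1_in in auto)
  show "(h1 ^^ n) c < c" if n: "0 < n"
  proof -
    obtain m where m: "n = Suc m" using n by (cases n) auto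
    have y: "(h1 ^^ m) c \<in> {0..1}" "(h1 ^^ m) c < 1" using 1[of m] c by auto
    then have "h1 ((h1 ^^ m) c) \<noteq> c" using S_h1[OF y(1)] Sc by auto
    then show ?thesis using h1_in[OF y(1)] m by auto
  qed
qed

text \<open>An orbit that stays in the left branch for \<open>n\<close> steps and then leaves it lies, step by step, to the right of
the backward orbit of the cusp, where the derivative is larger.\<close>
lemma contraction_le_cusp_preimages:
  assumes "y \<in> {0..1}" "\<And>i. i < n \<Longrightarrow> (S ^^ i) y \<le> c" "c \<le> (S ^^ n) y"
  shows "(h1 ^^ n) c \<le> y \<and> contraction n y \<le> (\<Prod>k<n. \<bar>v ((h1 ^^ Suc k) c)\<bar>)"
  using assms
proof (induction n arbitrary: y)
  case (Suc n)
  have IH: "(h1 ^^ n) c \<le> S y \<and> contraction n (S y) \<le> (\<Prod>k<n. \<bar>v ((h1 ^^ Suc k) c)\<bar>)"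
  proof (rule Suc.IH)
    fix i assume "i < n"
    then show "(S ^^ i) (S y) \<le> c" using Suc.prems(2)[of "Suc i"] by (simp add: funpow_swap1)
  next
    show "c \<le> (S ^^ n) (S y)" using Suc.prems(3) by (simp add: funpow_swap1)
  qed (rule S_in[OF Suc.prems(1)])
  have y: "y \<in> {0..c}" using Suc.prems(1) Suc.prems(2)[of 0] by auto
  have "(h1 ^^ Suc n) c = h1 ((h1 ^^ n) c)" by simp
  also have "\<dots> \<le> h1 (S y)"
    by (rule mono_onD[OF h1_mono]) (use IH S_in[OF Suc.prems(1)] cusp_preimages(1)[of n] c in auto)
  also have "\<dots> = y" by (rule h1_S[OF y])
  finally have le: "(h1 ^^ Suc n) c \<le> y" .
  have "v ((h1 ^^ Suc n) c) \<le> v y" "v y \<le> v c"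
    using mono_onD[OF v_mono, of "(h1 ^^ Suc n) c" y] mono_onD[OF v_mono, of y c] le y c
      cusp_preimages(1)[of "Suc n"] by auto
  then have "\<bar>v y\<bar> \<le> \<bar>v ((h1 ^^ Suc n) c)\<bar>" using v_c by auto
  then have "contraction (Suc n) y \<le> \<bar>v ((h1 ^^ Suc n) c)\<bar> * (\<Prod>k<n. \<bar>v ((h1 ^^ Suc k) c)\<bar>)"
    using IH contraction_nonneg by (auto intro!: mult_mono)
  then show ?case using le by (simp add: mult.commute)
qed simp

text \<open>If every point is expanded by a fixed factor within a bounded time, then the iterates expand uniformly:
concatenating the return blocks gives exponential decay with rate \<open>\<theta> = l powr (1 / P)\<close>, and only the last,
incomplete block costs a constant.\<close>
lemma eventual_expansion:
  assumes returns: "\<And>z. z \<in> {0..1} \<Longrightarrow> \<exists>p. 1 \<le> p \<and> p \<le> P \<and> contraction p z \<le> l"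
    and l: "0 < l" "l < 1"
  shows "\<exists>n. \<forall>z\<in>{0..1}. contraction n z \<le> 1 / 4"
proof -
  have P: "0 < P" using returns[of 0] by auto
  define \<theta> where "\<theta> = root P l"
  have \<theta>: "0 < \<theta>" "\<theta> < 1" "\<theta> ^ P = l"
    using P l by (auto simp: \<theta>_def real_root_pow_pos)
  define B where "B = max 1 (max \<bar>v 0\<bar> \<bar>v 1\<bar>)"
  have B: "1 \<le> B" "\<And>z. z \<in> {0..1} \<Longrightarrow> \<bar>v z\<bar> \<le> B" using v_bounded by (auto simp: B_def le_max_iff_disj)
  have triv: "contraction n z \<le> B ^ n" if "z \<in> {0..1}" for n z
    using that
  proof (induction n arbitrary: z)
    case (Suc n)
    then show ?case using B S_in[OF Suc.prems] contraction_nonneg by (auto intro!: mult_mono)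
  qed simp
  have main: "contraction n z \<le> (B / \<theta>) ^ P * \<theta> ^ n" if "z \<in> {0..1}" for n z
    using that
  proof (induction n arbitrary: z rule: less_induct)
    case (less n)
    show ?case
    proof (cases "n < P")
      case True
      have "contraction n z \<le> B ^ P"
        using triv[OF less.prems, of n] power_increasing[of n P B] B(1) True by linarith
      also have "\<dots> = (B / \<theta>) ^ P * \<theta> ^ P" using \<theta> l B(1) by (simp add: power_divide)
      also have "\<dots> \<le> (B / \<theta>) ^ P * \<theta> ^ n"
        using \<theta> B True by (intro mult_left_mono power_decreasing) auto
      finally show ?thesis .
    next
      case False
      obtain p where p: "1 \<le> p" "p \<le> P" "contraction p z \<le> l" using returns[OF less.prems] by blast
      have Sp: "(S ^^ p) z \<in> {0..1}"
        by (induction p) (use less.prems S_in in auto)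
      have "contraction n z = contraction p z * contraction (n - p) ((S ^^ p) z)"
        using contraction_add[of p "n - p" z] p False by simp
      also have "\<dots> \<le> \<theta> ^ p * ((B / \<theta>) ^ P * \<theta> ^ (n - p))"
      proof (rule mult_mono)
        have "l \<le> \<theta> ^ p" using \<theta> p power_decreasing[of p P \<theta>] by auto
        then show "contraction p z \<le> \<theta> ^ p" using p by linarith
        show "contraction (n - p) ((S ^^ p) z) \<le> (B / \<theta>) ^ P * \<theta> ^ (n - p)"
          by (rule less.IH) (use p False P Sp in auto)
      qed (use \<theta> contraction_nonneg in auto)
      also have "\<dots> = (B / \<theta>) ^ P * \<theta> ^ n"
        using p False power_add[of \<theta> p "n - p"] by simp
      finally show ?thesis .
    qed
  qed
  have "(\<lambda>n. (B / \<theta>) ^ P * \<theta> ^ n) \<longlonglongrightarrow> (B / \<theta>) ^ P * 0"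
    by (intro tendsto_mult tendsto_const LIMSEQ_power_zero) (use \<theta> in auto)
  then have "eventually (\<lambda>n. (B / \<theta>) ^ P * \<theta> ^ n < 1 / 4) sequentially"
    by (intro order_tendstoD(2)) auto
  then obtain n where "(B / \<theta>) ^ P * \<theta> ^ n < 1 / 4" by (auto simp: eventually_sequentially)
  then show ?thesis using main[of _ n] by (intro exI[of _ n]) fastforce
qed

end

context cusp_family begin

text \<open>Dropping the first \<open>k0\<close> maps makes the variation bound hold along the whole sequence.\<close>
lemma stability:
  assumes "\<And>z. z \<in> {0..1} \<Longrightarrow> T.contraction n0 z \<le> 1 / 4"
    and \<rho>: "unique_acip_density T \<rho>" "\<And>k. unique_acip_density (S k) (\<sigma> k)"
  shows "\<exists>r. (\<lambda>k. LINT x|leb01. \<bar>\<rho> x - \<sigma> (r k) x\<bar>) \<longlonglongrightarrow> 0"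
proof -
  obtain M where "eventually (\<lambda>k. \<forall>n. var_le ((P k ^^ n) (\<lambda>x. 1)) 0 1 M) sequentially"
    using uniform_variation_bound[OF assms(1)] by blast
  then obtain k0 where k0: "\<And>k n. k0 \<le> k \<Longrightarrow> var_le ((P k ^^ n) (\<lambda>x. 1)) 0 1 M"
    unfolding eventually_sequentially by blast
  have "\<exists>r. strict_mono (r::nat \<Rightarrow> nat) \<and> (\<lambda>k. LINT x|leb01. \<bar>\<rho> x - \<sigma> (r k + k0) x\<bar>) \<longlonglongrightarrow> 0"
  proof (rule stability_from_uniform_variation[OF T.cusp_system_axioms \<rho>(1),
        where S = "\<lambda>k. S (k + k0)" and c = "\<lambda>k. c (k + k0)" and w = "\<lambda>k. w (k + k0)"])
    show "(\<lambda>k. S (k + k0) x) \<longlonglongrightarrow> T x" if "x \<in> {0..1}" for x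
      using LIMSEQ_ignore_initial_segment[OF tendsto_uniform_limitI[OF S_lim that]] .
    show "var_le ((cusp_system.transfer (S (k + k0)) (c (k + k0)) (w (k + k0)) ^^ n) (\<lambda>x. 1)) 0 1 M" for k n
      by (rule k0) simp
  qed (rule S \<rho>(2))+
  then obtain r where "(\<lambda>k. LINT x|leb01. \<bar>\<rho> x - \<sigma> (r k + k0) x\<bar>) \<longlonglongrightarrow> 0" by blast
  then show ?thesis by (intro exI[where x = "\<lambda>k. r k + k0"])
qed

end

section \<open>Cusp maps and their perturbations\<close>

lemma tendsto_of_smallo_expansion:
  fixes f g :: "real \<Rightarrow> real"
  assumes "(\<lambda>x. f x - (a + k * g x)) \<in> o[F](g)" "(g \<longlongrightarrow> 0) F"
  shows "(f \<longlongrightarrow> a) F"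
proof -
  have "eventually (\<lambda>x. norm (f x - (a + k * g x)) \<le> 1 * norm (g x)) F"
    by (rule landau_o.smallD[OF assms(1)]) simp
  then have "((\<lambda>x. f x - (a + k * g x)) \<longlongrightarrow> 0) F"
    by (intro Lim_null_comparison[OF _ tendsto_norm_zero[OF assms(2)]]) simp
  from tendsto_add[OF this tendsto_add[OF tendsto_const[of a] tendsto_mult[OF tendsto_const[of k] assms(2)]]]
  show ?thesis by simp
qed

text \<open>The slopes in the local expansions at 0 and 1 are the one-sided derivatives there, because the derivative
is continuous up to the end points.\<close>
lemma cusp_map_end_slopes:
  assumes "cusp_map T x0 \<alpha>' \<alpha> \<iota> C" shows "D T 0 = \<alpha>'" "D T 1 = - \<alpha>"
proof -
  have x0: "0 < x0" "x0 < 1" and cont: "continuous_on ({0..1} - {x0}) (D T)"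
    and b0: "behaviour_at_0 T \<alpha>'" and b1: "behaviour_at_1 T \<alpha>"
    using assms by (auto simp: cusp_map_def cusp_behaviour_def)
  obtain \<psi> k where \<psi>: "\<psi> > 1" "(\<lambda>x. D T x - (\<alpha>' + k * x powr \<psi>)) \<in> o[at_right 0](\<lambda>x. x powr \<psi>)"
    using b0 by (auto simp: behaviour_at_0_def)
  have "((\<lambda>x::real. x powr \<psi>) \<longlongrightarrow> 0) (at_right 0)"
    by (rule tendsto_zero_powrI[where b = \<psi>]) (use \<psi>(1) in \<open>auto intro!: tendsto_eq_intros simp: eventually_at_filter\<close>)
  from tendsto_of_smallo_expansion[OF \<psi>(2) this] have "(D T \<longlongrightarrow> \<alpha>') (at_right 0)" .
  then have 1: "(D T \<longlongrightarrow> \<alpha>') (at 0 within {0<..<x0})" by (rule tendsto_within_subset) auto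
  have "(D T \<longlongrightarrow> D T 0) (at 0 within ({0..1} - {x0}))"
    using cont x0 by (auto simp: continuous_on_def)
  then have 2: "(D T \<longlongrightarrow> D T 0) (at 0 within {0<..<x0})"
    by (rule tendsto_within_subset) (use x0 in auto)
  have "at 0 within {0<..<x0} \<noteq> bot"
    using islimpt_greaterThanLessThan1[OF x0(1)] by (simp add: trivial_limit_within)
  from tendsto_unique[OF this 2 1] show "D T 0 = \<alpha>'" .
  obtain \<kappa> k where \<kappa>: "\<kappa> > 1"
    "(\<lambda>x. D T x - (- \<alpha> - k * (1 - x) powr \<kappa>)) \<in> o[at_left 1](\<lambda>x. (1 - x) powr \<kappa>)"
    using b1 by (auto simp: behaviour_at_1_def)
  have "((\<lambda>x::real. (1 - x) powr \<kappa>) \<longlongrightarrow> 0) (at_left 1)"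
    by (rule tendsto_zero_powrI[where b = \<kappa>]) (use \<kappa>(1) in \<open>auto intro!: tendsto_eq_intros simp: eventually_at_filter\<close>)
  with \<kappa>(2) have "(D T \<longlongrightarrow> - \<alpha>) (at_left 1)"
    using tendsto_of_smallo_expansion[of "D T" "- \<alpha>" "- k" "\<lambda>x. (1 - x) powr \<kappa>" "at_left 1"] by simp
  then have 1: "(D T \<longlongrightarrow> - \<alpha>) (at 1 within {x0<..<1})" by (rule tendsto_within_subset) auto
  have "(D T \<longlongrightarrow> D T 1) (at 1 within ({0..1} - {x0}))"
    using cont x0 by (auto simp: continuous_on_def)
  then have 2: "(D T \<longlongrightarrow> D T 1) (at 1 within {x0<..<1})"
    by (rule tendsto_within_subset) (use x0 in auto)
  have "at 1 within {x0<..<1} \<noteq> bot"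
    using islimpt_greaterThanLessThan2[OF x0(2)] by (simp add: trivial_limit_within)
  from tendsto_unique[OF this 2 1] show "D T 1 = - \<alpha>" .
qed

lemma cusp_map_slope_bounds:
  assumes "cusp_map T x0 \<alpha>' \<alpha> \<iota> C" shows "1 < \<alpha>'" "0 < \<alpha>" "\<alpha> < 1"
  using assms by (auto simp: cusp_map_def cusp_behaviour_def behaviour_at_0_def behaviour_at_1_def)

lemma cusp_map_cusp_system:
  assumes T: "cusp_map T x0 \<alpha>' \<alpha> \<iota> C" shows "cusp_system T x0 (neg_inverse_slope T x0)"
  by (rule cusp_systemI)
    (use T cusp_map_end_slopes[OF T] cusp_map_slope_bounds[OF T] in \<open>auto simp: cusp_map_def\<close>)

lemma cusp_map_neg_inverse_slope_cont:
  assumes T: "cusp_map T x0 \<alpha>' \<alpha> \<iota> C" shows "continuous_on {0..1} (neg_inverse_slope T x0)"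
proof -
  let ?v = "neg_inverse_slope T x0"
  interpret cusp_system T x0 ?v by (rule cusp_map_cusp_system[OF T])
  have nz: "D T x \<noteq> 0" if "x \<in> {0..1} - {x0}" for x
    using v_neg[of x] v_pos[of x] that by (cases "x < x0") (auto simp: neg_inverse_slope_def)
  have DT: "continuous_on ({0..1} - {x0}) (D T)" using T by (auto simp: cusp_map_def)
  have "continuous_on ({0..1} - {x0}) (\<lambda>x. - 1 / D T x)"
    using DT nz by (intro continuous_on_divide) auto
  then have off: "continuous_on ({0..1} - {x0}) ?v"
    by (rule continuous_on_cong[THEN iffD1, rotated -1]) (auto simp: neg_inverse_slope_def)
  show ?thesis unfolding continuous_on_def
  proof
    fix x :: real assume x: "x \<in> {0..1}"
    show "(?v \<longlongrightarrow> ?v x) (at x within {0..1})"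
    proof (cases "x = x0")
      case False
      have "at x within {0..1} = at x within ({0..1} - {x0})"
        by (rule at_within_nhd[where S = "- {x0}"]) (use False in auto)
      then show ?thesis using off x False by (auto simp: continuous_on_def)
    next
      case True
      have L: "filterlim (D T) at_top (at_left x0)" and R: "filterlim (D T) at_bot (at_right x0)"
        using T by (auto simp: cusp_map_def)
      have "((\<lambda>z. - 1 / D T z) \<longlongrightarrow> 0) (at_left x0)"
        by (rule tendsto_divide_0[OF tendsto_const filterlim_at_top_imp_at_infinity[OF L]])
      moreover have "((\<lambda>z. - 1 / D T z) \<longlongrightarrow> 0) (at_right x0)"
        by (rule tendsto_divide_0[OF tendsto_const filterlim_at_bot_imp_at_infinity[OF R]])
      ultimately have "((\<lambda>z. - 1 / D T z) \<longlongrightarrow> 0) (at x0)" by (simp add: filterlim_split_at)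
      then have "((\<lambda>z. - 1 / D T z) \<longlongrightarrow> 0) (at x0 within {0..1})"
        by (rule tendsto_within_subset) simp
      moreover have "eventually (\<lambda>z. - 1 / D T z = ?v z) (at x0 within {0..1})"
        by (auto simp: eventually_at_filter neg_inverse_slope_def)
      ultimately have "(?v \<longlongrightarrow> 0) (at x0 within {0..1})" by (rule Lim_transform_eventually)
      then show ?thesis using True v_c by simp
    qed
  qed
qed

text \<open>The return time of \<open>z\<close> is 1 if \<open>z \<le> a0\<close>.  If \<open>a0 < z\<close>, then \<open>z\<close> is mapped into the left branch.  Either
its orbit leaves that branch early, and the product condition on the preimages of the cusp applies, or it
stays there so long that the expansion at the fixed point 0 outweighs the contraction at 1.\<close>
lemma cusp_map_expanding_iterate:
  assumes T: "cusp_map T x0 \<alpha>' \<alpha> \<iota> C" and E: "expansion_conditions T x0 \<alpha>' \<alpha>"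
  shows "\<exists>n. \<forall>z\<in>{0..1}. cusp_system.contraction T (neg_inverse_slope T x0) n z \<le> 1 / 4"
proof -
  define v where "v = neg_inverse_slope T x0"
  interpret cusp_system T x0 v unfolding v_def by (rule cusp_map_cusp_system[OF T])
  have v_cont: "continuous_on {0..1} v" unfolding v_def by (rule cusp_map_neg_inverse_slope_cont[OF T])
  note ends = cusp_map_end_slopes[OF T] and \<alpha> = cusp_map_slope_bounds[OF T]
  have abs_v: "\<bar>v z\<bar> = inverse \<bar>D T z\<bar>" if "z \<noteq> x0" for z
    using that by (simp add: v_def neg_inverse_slope_def inverse_eq_divide)
  obtain \<beta> where \<beta>: "1 < \<beta>" "\<beta> \<le> d10 T x0" "\<beta> \<le> \<alpha>'"
    and short: "\<And>p::nat. 1 < p \<Longrightarrow> int p \<le> \<lfloor>1 + ln (\<beta> * inverse \<alpha>) / ln \<alpha>'\<rfloor> \<Longrightarrow>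
        \<bar>D T (pre_a T x0 (p - 1))\<bar> * (\<Prod>k\<le>p - 2. D T (pre_a' T x0 k)) > \<beta>"
    using E by (auto simp: expansion_conditions_def)
  \<comment> \<open>the backward orbit of the cusp in the left branch; it contains the points \<open>pre_a'\<close>,
    and their preimages in the right branch are the points \<open>pre_a\<close>\<close>
  define e where "e = (\<lambda>n. (h1 ^^ n) x0)"
  have e_in: "e n \<in> {0..x0}" "0 < n \<Longrightarrow> e n < x0" for n
    unfolding e_def by (rule cusp_preimages)+
  have pre_a': "pre_a' T x0 k = e (Suc k)" for k
    by (simp add: pre_a'_def e_def funpow_swap1)
  have pre_a: "pre_a T x0 k = h2 (e k)" for k
    by (cases k) (simp_all add: pre_a_def pre_a'_def e_def funpow_swap1)
  have bound_left: "\<bar>v z\<bar> \<le> 1 / \<alpha>'" if "z \<in> {0..x0}" for z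
  proof -
    have "v 0 \<le> v z" "v z \<le> v x0" using mono_onD[OF v_mono] that c by auto
    then show ?thesis using v_c c ends by (simp add: v_def neg_inverse_slope_def)
  qed
  have bound_all: "\<bar>v z\<bar> \<le> 1 / \<alpha>" if "z \<in> {0..1}" for z
  proof (cases "z \<le> x0")
    case True
    have "1 / \<alpha>' \<le> 1 / \<alpha>" using \<alpha> by (intro divide_left_mono) auto
    then show ?thesis using bound_left[of z] True that by simp
  next
    case False
    then have "v z \<le> v 1" "0 < v z" using mono_onD[OF v_mono, of z 1] v_pos[of z] that by auto
    then show ?thesis using c ends by (simp add: v_def neg_inverse_slope_def)
  qed
  define a0 where "a0 = h2 x0"
  have x0_in: "x0 \<in> {0..1}" using c by auto
  have Ta0: "T a0 = x0" and a0_in: "a0 \<in> {x0..1}" using S_h2[OF x0_in] h2_in[OF x0_in] by (auto simp: a0_def)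
  have a0: "x0 < a0" "a0 < 1" using a0_in Ta0 Sc S1 c by (auto simp: less_le)
  have a0_eq: "pre_a T x0 0 = a0" by (simp add: pre_a e_def a0_def)
  have bound_core: "\<bar>v z\<bar> \<le> 1 / \<beta>" if z: "x0 \<le> z" "z \<le> a0" for z
  proof -
    define b1 where "b1 = point_b1 T x0"
    have a0_01: "a0 \<in> {0..1}" using a0 c by auto
    have "h2 a0 < a0" using dec_less_iff[of a0 "h2 a0"] h2_in[OF a0_01] S_h2[OF a0_01] a0 Ta0 by auto
    moreover have "x0 \<noteq> h2 a0" using S_h2[OF a0_01] Sc a0 by auto
    ultimately have "h2 a0 \<in> {x0<..<a0}" using h2_in[OF a0_01] by auto
    then have "a0 \<in> T ` {x0<..<a0}" using S_h2[OF a0_01] by (metis imageI)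
    then have b1: "x0 < b1" "b1 < a0"
      unfolding b1_def point_b1_def a0_eq using inv_into_into[of a0 T "{x0<..<a0}"] by auto
    have below: "v y \<le> 1 / \<beta>" if "x0 \<le> y" "y < a0" for y
    proof -
      define x where "x = (max b1 y + a0) / 2"
      have x: "b1 < x" "y < x" "x < a0" using that b1 by (auto simp: x_def)
      have "d10 T x0 \<le> \<bar>D T x\<bar>"
        unfolding d10_def a0_eq
        by (rule cINF_lower) (use x in \<open>auto simp: b1_def intro!: bdd_belowI[of _ 0]\<close>)
      then have "inverse \<bar>D T x\<bar> \<le> inverse \<beta>" using \<beta> by (intro le_imp_inverse_le) auto
      then have "\<bar>v x\<bar> \<le> 1 / \<beta>" using abs_v[of x] x b1 by (simp add: inverse_eq_divide)
      moreover have "v y \<le> v x" using mono_onD[OF v_mono, of y x] x that a0 c by auto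
      ultimately show ?thesis by auto
    qed
    \<comment> \<open>the infimum \<open>d10\<close> does not involve \<open>a0\<close> itself, so continuity is used\<close>
    have "v a0 \<le> 1 / \<beta>"
    proof (rule tendsto_upperbound)
      have "(v \<longlongrightarrow> v a0) (at a0 within {0..1})" using v_cont a0_01 by (auto simp: continuous_on_def)
      then show "(v \<longlongrightarrow> v a0) (at a0 within {x0<..<a0})"
        by (rule tendsto_within_subset) (use a0 c in auto)
      show "\<forall>\<^sub>F y in at a0 within {x0<..<a0}. v y \<le> 1 / \<beta>"
        unfolding eventually_at_filter by (rule always_eventually) (use below in auto)
      show "at a0 within {x0<..<a0} \<noteq> bot"
        using islimpt_greaterThanLessThan2[OF a0(1)] by (simp add: trivial_limit_within)
    qed
    then have "v z \<le> 1 / \<beta>" using below[of z] z by (cases "z = a0") auto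
    moreover have "0 \<le> v z" using v_pos[of z] v_c z a0 by (cases "z = x0") auto
    ultimately show ?thesis by simp
  qed
  define ps where "ps = nat \<lfloor>1 + ln (\<beta> * inverse \<alpha>) / ln \<alpha>'\<rfloor>"
  have ratio: "1 < \<beta> * inverse \<alpha>"
    using \<alpha> \<beta>(1) by (simp add: field_simps)
  then have ln_pos: "0 < ln (\<beta> * inverse \<alpha>) / ln \<alpha>'" using \<alpha> by (intro divide_pos_pos) auto
  then have ps1: "1 \<le> ps" unfolding ps_def by linarith
  have ps_ln: "ln (\<beta> * inverse \<alpha>) / ln \<alpha>' < real ps" unfolding ps_def using ln_pos by linarith
  have ps_int: "int ps = \<lfloor>1 + ln (\<beta> * inverse \<alpha>) / ln \<alpha>'\<rfloor>" unfolding ps_def using ln_pos by linarith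
  have power: "\<beta> / \<alpha> \<le> \<alpha>' ^ ps"
  proof -
    have "ln (\<beta> / \<alpha>) < real ps * ln \<alpha>'"
      using pos_divide_less_eq[of "ln \<alpha>'" "ln (\<beta> * inverse \<alpha>)" "real ps"] ps_ln \<alpha>
      by (simp add: divide_inverse)
    also have "\<dots> = ln (\<alpha>' ^ ps)" using \<alpha> by (simp add: ln_realpow)
    finally show ?thesis using \<alpha> \<beta>(1) by simp
  qed
  have returns: "\<exists>p. 1 \<le> p \<and> p \<le> ps + 1 \<and> contraction p z \<le> 1 / \<beta>" if z: "z \<in> {0..1}" for z
  proof -
    consider "z \<le> x0" | "x0 < z" "z \<le> a0" | "a0 < z" by linarith
    then show ?thesis
    proof cases
      case 1
      have "1 / \<alpha>' \<le> 1 / \<beta>" using \<beta> by (intro divide_left_mono) auto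
      then show ?thesis using bound_left[of z] 1 z by (intro exI[of _ 1]) auto
    next
      case 2
      then show ?thesis using bound_core[of z] by (intro exI[of _ 1]) auto
    next
      case 3
      have Tz: "T z < x0" using dec_less_iff[of z a0] 3 z a0 Ta0 by auto
      have Tz_in: "T z \<in> {0..1}" by (rule S_in[OF z])
      show ?thesis
      \<comment> \<open>does the orbit stay in the left branch for all of the next \<open>ps\<close> steps?\<close>
      proof (cases "\<forall>i<ps. (T ^^ i) (T z) \<le> x0")
        case True
        have "contraction ps (T z) \<le> (1 / \<alpha>') ^ ps"
          by (rule contraction_le_power[OF Tz_in]) (use True bound_left in auto)
        then have "\<bar>v z\<bar> * contraction ps (T z) \<le> (1 / \<alpha>) * (1 / \<alpha>') ^ ps"
          using bound_all[OF z] contraction_nonneg \<alpha> by (intro mult_mono) auto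
        then have "contraction (Suc ps) z \<le> (1 / \<alpha>) * (1 / \<alpha>') ^ ps" by simp
        also have "\<dots> \<le> 1 / \<beta>"
          using power \<alpha> \<beta>(1) by (simp add: power_divide field_simps)
        finally show ?thesis by (intro exI[of _ "Suc ps"]) auto
      next
        case False
        define m where "m = (LEAST i. x0 < (T ^^ i) (T z))"
        obtain i where i: "i < ps" "x0 < (T ^^ i) (T z)" using False by auto
        have m: "x0 < (T ^^ m) (T z)" unfolding m_def by (rule LeastI[of _ i]) (rule i(2))
        have m_least: "(T ^^ i) (T z) \<le> x0" if "i < m" for i
          using not_less_Least[of i "\<lambda>i. x0 < (T ^^ i) (T z)"] that by (auto simp: m_def)
        have "m \<le> i" unfolding m_def by (rule Least_le) (rule i(2))
        have "m \<noteq> 0" using m Tz by (intro notI) auto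
        have cp: "e m \<le> T z" "contraction m (T z) \<le> (\<Prod>k<m. \<bar>v (e (Suc k))\<bar>)"
          using contraction_le_cusp_preimages[OF Tz_in, of m] m m_least by (auto simp: e_def)
        have em: "e m \<in> {0..1}" "e m < 1" using e_in(1)[of m] c by auto
        have "h2 (T z) \<le> h2 (e m)"
          using monotone_onD[OF h2_antimono, of "e m" "T z"] cp(1) em Tz_in by auto
        then have "z \<le> h2 (e m)" using h2_S[of z] 3 a0 z by auto
        moreover have h: "h2 (e m) \<in> {x0..1}" "h2 (e m) \<noteq> x0"
          using h2_in[OF em(1)] S_h2[OF em(1)] Sc em by auto
        ultimately have "v z \<le> v (h2 (e m))" "0 < v z"
          using mono_onD[OF v_mono, of z "h2 (e m)"] v_pos[of z] z 3 a0 by auto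
        then have "contraction (Suc m) z \<le> \<bar>v (h2 (e m))\<bar> * (\<Prod>k<m. \<bar>v (e (Suc k))\<bar>)"
          using cp(2) by (auto intro!: mult_mono contraction_nonneg)
        also have "\<dots> = inverse (\<bar>D T (h2 (e m))\<bar> * (\<Prod>k<m. \<bar>D T (e (Suc k))\<bar>))"
        proof -
          have "\<bar>v (e (Suc k))\<bar> = inverse \<bar>D T (e (Suc k))\<bar>" for k
            using e_in(2)[of "Suc k"] by (intro abs_v) auto
          then show ?thesis using abs_v[OF h(2)]
            by (simp add: prod_inversef[symmetric] o_def inverse_mult_distrib)
        qed
        also have "\<dots> \<le> inverse \<beta>"
        proof (rule le_imp_inverse_le)
          have "{..Suc m - 2} = {..<m}" using \<open>m \<noteq> 0\<close> by (auto simp: le_eq_less_or_eq)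
          then have "\<beta> < \<bar>D T (h2 (e m))\<bar> * (\<Prod>k<m. D T (e (Suc k)))"
            using short[of "Suc m"] \<open>m \<noteq> 0\<close> \<open>m \<le> i\<close> i(1) ps_int by (simp add: pre_a pre_a')
          also have "\<dots> \<le> \<bar>D T (h2 (e m))\<bar> * (\<Prod>k<m. \<bar>D T (e (Suc k))\<bar>)"
            by (intro mult_left_mono) (simp_all add: abs_prod[symmetric])
          finally show "\<beta> \<le> \<bar>D T (h2 (e m))\<bar> * (\<Prod>k<m. \<bar>D T (e (Suc k))\<bar>)" by simp
        qed (use \<beta> in simp)
        finally show ?thesis using \<open>m \<le> i\<close> i(1) by (intro exI[of _ "Suc m"]) (auto simp: inverse_eq_divide)
      qed
    qed
  qed
  have "\<exists>n. \<forall>z\<in>{0..1}. contraction n z \<le> 1 / 4"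
    by (rule eventual_expansion[OF returns]) (use \<beta> in auto)
  then show ?thesis by (simp add: v_def)
qed

lemma perturbed_cusp_system:
  assumes "perturbed_cusp_map S c \<iota> C" "diff01 S 0" "diff01 S 1" "0 < D S 0" "D S 1 < 0"
  shows "cusp_system S c (neg_inverse_slope S c)"
proof (rule cusp_systemI)
  fix x assume "x \<in> {0..1} - {c}"
  then show "diff01 S x"
    using assms by (cases "x = 0"; cases "x = 1") (auto simp: perturbed_cusp_map_def C1_holder_def)
qed (use assms in \<open>auto simp: perturbed_cusp_map_def bij_betw_def\<close>)

lemma sup_distance_imp_uniform_limit:
  fixes T :: "real \<Rightarrow> real" and S :: "nat \<Rightarrow> real \<Rightarrow> real"
  assumes range: "\<And>x. x \<in> {0..1} \<Longrightarrow> T x \<in> {0..1}" "\<And>k x. x \<in> {0..1} \<Longrightarrow> S k x \<in> {0..1}"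
    and lim: "(\<lambda>k. SUP x\<in>{0..1}. \<bar>S k x - T x\<bar>) \<longlonglongrightarrow> 0"
  shows "uniform_limit {0..1} S T sequentially"
proof (rule uniform_limitI)
  fix e :: real assume "0 < e"
  from order_tendstoD(2)[OF lim this]
  show "\<forall>\<^sub>F k in sequentially. \<forall>x\<in>{0..1}. dist (S k x) (T x) < e"
  proof eventually_elim
    case (elim k)
    show ?case
    proof
      fix x :: real assume x: "x \<in> {0..1}"
      have "\<bar>S k y - T y\<bar> \<le> 1" if "y \<in> {0..1}" for y using range(1)[OF that] range(2)[OF that, of k] by auto
      then have "bdd_above ((\<lambda>x. \<bar>S k x - T x\<bar>) ` {0..1})" by (auto intro!: bdd_aboveI[of _ 1])
      then have "\<bar>S k x - T x\<bar> \<le> (SUP x\<in>{0..1}. \<bar>S k x - T x\<bar>)" using x by (intro cSUP_upper)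
      then show "dist (S k x) (T x) < e" using elim by (simp add: dist_real_def)
    qed
  qed
qed

theorem proposition7:
  fixes T :: "real \<Rightarrow> real" and T\<epsilon> :: "real \<Rightarrow> real \<Rightarrow> real"
    and x0 :: real and x\<epsilon> :: "real \<Rightarrow> real"
    and \<iota> :: real and \<iota>\<epsilon> :: "real \<Rightarrow> real"
    and C :: "real \<Rightarrow> real \<Rightarrow> real" and C\<epsilon> :: "real \<Rightarrow> real \<Rightarrow> real \<Rightarrow> real"
    and \<rho> :: "real \<Rightarrow> real" and \<rho>\<epsilon> :: "real \<Rightarrow> real \<Rightarrow> real"
  assumes "lorenz_cusp_map T x0 \<iota> C"
    and "\<forall>\<^sub>F \<epsilon> in at_right 0. perturbed_cusp_map (T\<epsilon> \<epsilon>) (x\<epsilon> \<epsilon>) (\<iota>\<epsilon> \<epsilon>) (C\<epsilon> \<epsilon>)"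
    and "maps_converge T\<epsilon> T x0"
    and "holder_data_converge C\<epsilon> \<iota>\<epsilon> C \<iota> x0"
    and "core_expansion_close T\<epsilon> x\<epsilon> T x0"
    and "unique_acip_density T \<rho>"
    and "\<forall>\<^sub>F \<epsilon> in at_right 0. unique_acip_density (T\<epsilon> \<epsilon>) (\<rho>\<epsilon> \<epsilon>)"
  shows "((\<lambda>\<epsilon>. LINT x|leb01. \<bar>\<rho> x - \<rho>\<epsilon> \<epsilon> x\<bar>) \<longlongrightarrow> 0) (at_right 0)"
proof (rule ccontr)
  define d where "d = (\<lambda>\<epsilon>. LINT x|leb01. \<bar>\<rho> x - \<rho>\<epsilon> \<epsilon> x\<bar>)"
  assume "\<not> ?thesis"
  then obtain \<eta> where \<eta>: "0 < \<eta>" and far: "\<not> eventually (\<lambda>\<epsilon>. dist (d \<epsilon>) 0 < \<eta>) (at_right 0)"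
    by (auto simp: tendsto_iff d_def)
  obtain \<alpha>' \<alpha> where T: "cusp_map T x0 \<alpha>' \<alpha> \<iota> C" and E: "expansion_conditions T x0 \<alpha>' \<alpha>"
    using assms(1) by (auto simp: lorenz_cusp_map_def)
  let ?v = "neg_inverse_slope T x0"
  interpret T: cusp_system T x0 ?v by (rule cusp_map_cusp_system[OF T])
  note ends = cusp_map_end_slopes[OF T] and \<alpha> = cusp_map_slope_bounds[OF T]
  have sup_lim: "((\<lambda>\<epsilon>. SUP x\<in>{0..1}. \<bar>T\<epsilon> \<epsilon> x - T x\<bar>) \<longlongrightarrow> 0) (at_right 0)"
    using assms(3) by (auto simp: maps_converge_def)
  have D_lim: "((\<lambda>\<epsilon>. D (T\<epsilon> \<epsilon>) x) \<longlongrightarrow> D T x) (at_right 0)" if "x \<in> {0..1} - {x0}" for x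
    using assms(3) that unfolding maps_converge_def by blast
  have diff: "eventually (\<lambda>\<epsilon>. diff01 (T\<epsilon> \<epsilon>) x) (at_right 0)" if x: "x \<in> {0..1} - {x0}" for x
  proof -
    obtain e where "0 < e" "\<forall>\<epsilon>. 0 < \<epsilon> \<and> \<epsilon> < e \<longrightarrow> diff01 (T\<epsilon> \<epsilon>) x"
      using assms(3) x unfolding maps_converge_def by blast
    then show ?thesis unfolding eventually_at_right_field by auto
  qed
  have e01: "0 \<in> {0..1} - {x0}" "1 \<in> {0..1} - {x0}" using T.c by auto
  define good where "good = (\<lambda>\<epsilon>. cusp_system (T\<epsilon> \<epsilon>) (x\<epsilon> \<epsilon>) (neg_inverse_slope (T\<epsilon> \<epsilon>) (x\<epsilon> \<epsilon>)) \<and>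
      unique_acip_density (T\<epsilon> \<epsilon>) (\<rho>\<epsilon> \<epsilon>))"
  have "eventually (\<lambda>\<epsilon>. 0 < D (T\<epsilon> \<epsilon>) 0) (at_right 0)"
    by (rule order_tendstoD(1)[OF D_lim[OF e01(1)]]) (use ends \<alpha> in auto)
  moreover have "eventually (\<lambda>\<epsilon>. D (T\<epsilon> \<epsilon>) 1 < 0) (at_right 0)"
    by (rule order_tendstoD(2)[OF D_lim[OF e01(2)]]) (use ends \<alpha> in auto)
  ultimately have good: "eventually good (at_right 0)"
    using assms(2,7) diff[OF e01(1)] diff[OF e01(2)]
    unfolding good_def by eventually_elim (auto intro: perturbed_cusp_system)
  \<comment> \<open>a sequence of parameters tending to 0 along which the distance stays above \<open>\<eta>\<close>\<close>
  have "\<exists>\<epsilon>. 0 < \<epsilon> \<and> \<epsilon> < 1 / real (Suc k) \<and> good \<epsilon> \<and> \<eta> \<le> d \<epsilon>" for k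
  proof (rule ccontr)
    assume none: "\<not> ?thesis"
    have "eventually (\<lambda>\<epsilon>. \<epsilon> \<in> {0<..<1 / real (Suc k)}) (at_right (0::real))"
      by (rule eventually_at_right_real) simp
    with good have "eventually (\<lambda>\<epsilon>. dist (d \<epsilon>) 0 < \<eta>) (at_right 0)"
    proof eventually_elim
      case (elim \<epsilon>)
      have "0 \<le> d \<epsilon>" unfolding d_def by (rule integral_nonneg_AE) simp
      then show ?case using elim none by (auto simp: not_le)
    qed
    with far show False by contradiction
  qed
  then have "\<forall>k. \<exists>\<epsilon>. 0 < \<epsilon> \<and> \<epsilon> < 1 / real (Suc k) \<and> good \<epsilon> \<and> \<eta> \<le> d \<epsilon>" by blast
  then obtain s where "\<forall>k. 0 < s k \<and> s k < 1 / real (Suc k) \<and> good (s k) \<and> \<eta> \<le> d (s k)"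
    by (rule choice[THEN exE])
  then have s: "0 < s k" "s k < 1 / real (Suc k)" "good (s k)" "\<eta> \<le> d (s k)" for k by blast+
  have "s \<longlonglongrightarrow> 0"
    by (rule Lim_null_comparison[OF always_eventually LIMSEQ_Suc[OF lim_const_over_n[of 1]]])
      (use s(1,2) in \<open>auto simp: less_imp_le\<close>)
  then have s_lim: "filterlim s (at_right 0) sequentially"
    using s(1) by (auto simp: filterlim_at intro!: always_eventually less_imp_neq[symmetric])
  have S: "cusp_system (T\<epsilon> (s k)) (x\<epsilon> (s k)) (neg_inverse_slope (T\<epsilon> (s k)) (x\<epsilon> (s k)))" for k
    using s(3)[of k] by (simp add: good_def)
  have S_lim: "uniform_limit {0..1} (\<lambda>k. T\<epsilon> (s k)) T sequentially"
    by (rule sup_distance_imp_uniform_limit[OF T.S_in cusp_system.S_in[OF S] filterlim_compose[OF sup_lim s_lim]])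
  have w_lim: "uniform_limit {0..1} (\<lambda>k. neg_inverse_slope (T\<epsilon> (s k)) (x\<epsilon> (s k))) ?v sequentially"
  proof (rule monotone_pointwise_imp_uniform_limit[OF cusp_system.v_mono[OF S]
        cusp_map_neg_inverse_slope_cont[OF T] _ T.c])
    fix x assume x: "x \<in> {0..1} - {x0}"
    have "D T x \<noteq> 0"
      using T.v_neg[of x] T.v_pos[of x] x by (cases "x < x0") (auto simp: neg_inverse_slope_def)
    then have "(\<lambda>k. - 1 / D (T\<epsilon> (s k)) x) \<longlonglongrightarrow> - 1 / D T x"
      by (intro tendsto_divide tendsto_const filterlim_compose[OF D_lim[OF x] s_lim])
    \<comment> \<open>\<open>T x < 1\<close>, so \<open>x\<close> is not the cusp of a map close to \<open>T\<close>\<close>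
    moreover have "eventually (\<lambda>k. - 1 / D (T\<epsilon> (s k)) x = neg_inverse_slope (T\<epsilon> (s k)) (x\<epsilon> (s k)) x) sequentially"
    proof -
      have "T x < 1"
        using T.inc_less_iff[of x x0] T.dec_less_iff[of x x0] T.Sc x T.c by (cases "x < x0") auto
      then have "eventually (\<lambda>k. T\<epsilon> (s k) x < 1) sequentially"
        using order_tendstoD(2)[OF tendsto_uniform_limitI[OF S_lim, of x]] x by auto
      then show ?thesis
      proof eventually_elim
        case (elim k)
        then have "x \<noteq> x\<epsilon> (s k)" using cusp_system.Sc[OF S, of k] by auto
        then show ?case by (simp add: neg_inverse_slope_def)
      qed
    qed
    ultimately have "(\<lambda>k. neg_inverse_slope (T\<epsilon> (s k)) (x\<epsilon> (s k)) x) \<longlonglongrightarrow> - 1 / D T x"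
      by (rule Lim_transform_eventually)
    then show "(\<lambda>k. neg_inverse_slope (T\<epsilon> (s k)) (x\<epsilon> (s k)) x) \<longlonglongrightarrow> ?v x"
      using x by (simp add: neg_inverse_slope_def)
  qed
  interpret cusp_family T x0 ?v "\<lambda>k. T\<epsilon> (s k)" "\<lambda>k. x\<epsilon> (s k)" "\<lambda>k. neg_inverse_slope (T\<epsilon> (s k)) (x\<epsilon> (s k))"
    by (rule cusp_family.intro[OF T.cusp_system_axioms cusp_family_axioms.intro])
      (rule cusp_map_neg_inverse_slope_cont[OF T] S S_lim w_lim)+
  obtain n0 where "\<forall>z\<in>{0..1}. T.contraction n0 z \<le> 1 / 4"
    using cusp_map_expanding_iterate[OF T E] by blast
  then have "\<exists>r. (\<lambda>k. LINT x|leb01. \<bar>\<rho> x - \<rho>\<epsilon> (s (r k)) x\<bar>) \<longlonglongrightarrow> 0"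
    using s(3) by (intro stability[OF _ assms(6)]) (auto simp: good_def)
  then obtain r where "(\<lambda>k. d (s (r k))) \<longlonglongrightarrow> 0" by (auto simp: d_def)
  moreover have "\<eta> \<le> d (s (r k))" for k by (rule s(4))
  ultimately have "\<eta> \<le> 0" by (intro LIMSEQ_le_const) auto
  with \<eta> show False by simp
qed

end
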